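(* Let $G$ be a finite, simple, undirected graph on $n$ vertices, and let $\overline{G}$ denote its complement. 1. If $G$ is vertex-transitive or strongly regular, then $\alpha(G\boxtimes\overline{G})=\Theta(G\boxtimes\overline{G})=\vartheta(G\boxtimes\overline{G})=n$. 2. If $G$ is a conference graph, then $\vartheta(G)=\sqrt{n}$. 3. If $G$ is self-complementary and $\alpha(G)=k$, then $\sqrt{n}\le\Theta(G)\le 16\,n^{\frac{k-1}{k+1}}$. 4. If $G$ is self-complementary and is vertex-transitive or strongly regular, then $\Theta(G)=\sqrt{n}=\vartheta(G)$ and $\sqrt{\alpha(G\boxtimes G)}=\Theta(G)$. Hence the minimum Shannon capacity among all self-complementary graphs of order $n$ is attained by those that are vertex-transitive or strongly regular, and equals $\sqrt{n}$.
   Context: All graphs are finite, simple and undirected. $\alpha(G)$ is the independence number. The strong product $G\boxtimes H$ has vertex set $V(G)\times V(H)$, with distinct $(g,h),(g',h')$ adjacent iff ($g=g'$ or $\{g,g'\}\in E(G)$) and ($h=h'$ or $\{h,h'\}\in E(H)$). $G^{\boxtimes k}$ is the $k$-fold strong power, and the Shannon capacity is $\Theta(G)=\sup_{k\ge1}\alpha(G^{\boxtimes k})^{1/k}$. The Lovász $\vartheta$-function of a graph $G$ with vertex set $\{1,\dots,n\}$ is $\vartheta(G)=\max \mathrm{Tr}(BJ_n)$ over all real symmetric positive semidefinite $n\times n$ matrices $B$ with $\mathrm{Tr}(B)=1$ and $B_{i,j}=0$ whenever $\{i,j\}\in E(G)$ ($J_n$ is the all-ones matrix). A graph is self-complementary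 if it is isomorphic to its complement. A strongly regular graph with parameters $(n,d,\lambda,\mu)$ is a $d$-regular graph on $n$ vertices, neither complete nor edgeless, in which every two adjacent vertices have exactly $\lambda$ common neighbours and every two distinct nonadjacent vertices have exactly $\mu$ common neighbours. A conference graph on $n$ vertices is a strongly regular graph with parameters $(n,\tfrac12(n-1),\tfrac14(n-5),\tfrac14(n-1))$, $n\ge5$. A graph is vertex-transitive if its automorphism group acts transitively on its vertices. *)

theory Defs
  imports Complex_Main
begin

record 'a sgraph =
  verts :: "'a set"
  adj :: "'a \<Rightarrow> 'a \<Rightarrow> bool"

definition simple_graph :: "'a sgraph \<Rightarrow> bool" where
  "simple_graph G \<longleftrightarrow> finite (verts G) \<and>
     (\<forall>x y. adj G x y \<longrightarrow> x \<in> verts G \<and> y \<in> verts G) \<and>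
     (\<forall>x y. adj G x y \<longrightarrow> adj G y x) \<and>
     (\<forall>x. \<not> adj G x x)"

definition complement :: "'a sgraph \<Rightarrow> 'a sgraph" where
  "complement G = \<lparr>verts = verts G,
     adj = (\<lambda>x y. x \<in> verts G \<and> y \<in> verts G \<and> x \<noteq> y \<and> \<not> adj G x y)\<rparr>"

definition strong_product :: "'a sgraph \<Rightarrow> 'b sgraph \<Rightarrow> ('a \<times> 'b) sgraph" where
  "strong_product G H = \<lparr>verts = verts G \<times> verts H,
     adj = (\<lambda>(g, h) (g', h'). g \<in> verts G \<and> g' \<in> verts G \<and> h \<in> verts H \<and> h' \<in> verts H
              \<and> (g, h) \<noteq> (g', h')
              \<and> (g = g' \<or> adj G g g') \<and> (h = h' \<or> adj H h h'))\<rparr>"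

definition strong_power :: "'a sgraph \<Rightarrow> nat \<Rightarrow> 'a list sgraph" where
  "strong_power G k = \<lparr>verts = {xs. length xs = k \<and> set xs \<subseteq> verts G},
     adj = (\<lambda>xs ys. length xs = k \<and> set xs \<subseteq> verts G \<and> length ys = k \<and> set ys \<subseteq> verts G
              \<and> xs \<noteq> ys \<and> (\<forall>i<k. xs ! i = ys ! i \<or> adj G (xs ! i) (ys ! i)))\<rparr>"

definition independent_set :: "'a sgraph \<Rightarrow> 'a set \<Rightarrow> bool" where
  "independent_set G S \<longleftrightarrow> S \<subseteq> verts G \<and> (\<forall>x\<in>S. \<forall>y\<in>S. \<not> adj G x y)"

definition independence_number :: "'a sgraph \<Rightarrow> nat" where
  "independence_number G = Max (card ` {S. independent_set G S})"

definition shannon_capacity :: "'a sgraph \<Rightarrow> real" where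
  "shannon_capacity G = (SUP k\<in>{1..}. root k (real (independence_number (strong_power G k))))"

definition psd_on :: "'a set \<Rightarrow> ('a \<Rightarrow> 'a \<Rightarrow> real) \<Rightarrow> bool" where
  "psd_on V B \<longleftrightarrow> (\<forall>i\<in>V. \<forall>j\<in>V. B i j = B j i) \<and>
     (\<forall>x :: 'a \<Rightarrow> real. (\<Sum>i\<in>V. \<Sum>j\<in>V. x i * B i j * x j) \<ge> 0)"

definition lovasz_theta :: "'a sgraph \<Rightarrow> real" where
  "lovasz_theta G = Sup {(\<Sum>i\<in>verts G. \<Sum>j\<in>verts G. B i j) | B.
     psd_on (verts G) B \<and> (\<Sum>i\<in>verts G. B i i) = 1 \<and>
     (\<forall>i\<in>verts G. \<forall>j\<in>verts G. adj G i j \<longrightarrow> B i j = 0)}"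

definition self_complementary :: "'a sgraph \<Rightarrow> bool" where
  "self_complementary G \<longleftrightarrow> (\<exists>f. bij_betw f (verts G) (verts G) \<and>
     (\<forall>x\<in>verts G. \<forall>y\<in>verts G. adj G x y \<longleftrightarrow> adj (complement G) (f x) (f y)))"

definition automorphism :: "'a sgraph \<Rightarrow> ('a \<Rightarrow> 'a) \<Rightarrow> bool" where
  "automorphism G f \<longleftrightarrow> bij_betw f (verts G) (verts G) \<and>
     (\<forall>x\<in>verts G. \<forall>y\<in>verts G. adj G x y \<longleftrightarrow> adj G (f x) (f y))"

definition vertex_transitive :: "'a sgraph \<Rightarrow> bool" where
  "vertex_transitive G \<longleftrightarrow>
     (\<forall>u\<in>verts G. \<forall>v\<in>verts G. \<exists>f. automorphism G f \<and> f u = v)"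

definition neighbours :: "'a sgraph \<Rightarrow> 'a \<Rightarrow> 'a set" where
  "neighbours G x = {y \<in> verts G. adj G x y}"

definition strongly_regular_params :: "'a sgraph \<Rightarrow> nat \<Rightarrow> nat \<Rightarrow> nat \<Rightarrow> nat \<Rightarrow> bool" where
  "strongly_regular_params G n d l m \<longleftrightarrow>
     card (verts G) = n \<and>
     (\<forall>x\<in>verts G. card (neighbours G x) = d) \<and>
     (\<exists>x\<in>verts G. \<exists>y\<in>verts G. x \<noteq> y \<and> \<not> adj G x y) \<and>
     (\<exists>x y. adj G x y) \<and>
     (\<forall>x\<in>verts G. \<forall>y\<in>verts G. adj G x y \<longrightarrow> card (neighbours G x \<inter> neighbours G y) = l) \<and>
     (\<forall>x\<in>verts G. \<forall>y\<in>verts G. x \<noteq> y \<longrightarrow> \<not> adj G x y \<longrightarrow>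
        card (neighbours G x \<inter> neighbours G y) = m)"

definition strongly_regular :: "'a sgraph \<Rightarrow> bool" where
  "strongly_regular G \<longleftrightarrow> (\<exists>n d l m. strongly_regular_params G n d l m)"

definition conference_graph :: "'a sgraph \<Rightarrow> bool" where
  "conference_graph G \<longleftrightarrow> (let n = card (verts G) in n \<ge> 5 \<and>
     (\<exists>d l m. strongly_regular_params G n d l m \<and>
        real d = (real n - 1) / 2 \<and> real l = (real n - 5) / 4 \<and> real m = (real n - 1) / 4))"

end

theory Submission
  imports Defs "HOL-Analysis.Function_Topology" "HOL-Analysis.Convex" "HOL-Combinatorics.Permutations"
begin

text \<open>A number \<open>t\<close> is certified as an upper bound for \<open>\<vartheta>(G)\<close> by a matrix \<open>M\<close> with diagonal
  \<open>t\<close>, with zeros at the nonadjacent pairs and with \<open>M - J\<close> positive semidefinite. Such certificates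
  multiply under strong products, so they also bound the Shannon capacity. Semidefinite duality
  certifies \<open>\<vartheta>(G)\<close> itself. Since the diagonal is independent in the strong product of \<open>G\<close> and its
  complement, bounds certified for the two graphs have product at least \<open>n\<close>; the point is to find a
  pair of certificates with product exactly \<open>n\<close>. For vertex-transitive graphs these are the two theta
  values, by averaging over the automorphism group; for strongly regular graphs they are written down
  from the eigenvalues.

  For self-complementary \<open>G\<close>, Ramsey's theorem gives \<open>n < 4\<^sup>k\<close>, which makes \<open>16 n\<^bsup>(k-1)/(k+1)\<^esup>\<close> exceed
  the trivial bound \<open>n\<close> on the capacity.\<close>

section \<open>Positive semidefinite matrices\<close>

text \<open>The obstacle is attainment. \<open>lovasz_theta\<close> is a supremum over the primal
  program, and averaging only bounds a product of two such suprema, whereas passing to graph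
  products requires actual dual matrices. Strong duality supplies them. Its compactness comes from
  prescribing the diagonal, which bounds every entry of a psd matrix.

  Attainment also gives lower bounds on the theta function: its own certificate, paired with a
  certificate \<open>t\<close> for the complement, forces \<open>lovasz_theta G * t\<close> to be at
  least \<open>n\<close>. This settles conference graphs and self-complementary graphs.

  Instead \<open>I\<close>, \<open>A\<close> and \<open>J\<close> span an algebra, and within that
  span the certificates are Hoffman's ratio bounds for the graph and for its complement.

  For self-complementary graphs the diagonal is twisted by the isomorphism with the complement,
  which turns it into an independent set of the square of \<open>G\<close> itself.\<close>

lemma psd_onI:
  assumes "\<And>i j. i \<in> V \<Longrightarrow> j \<in> V \<Longrightarrow> B i j = B j i"
    and "\<And>x :: 'a \<Rightarrow> real. (\<Sum>i\<in>V. \<Sum>j\<in>V. x i * B i j * x j) \<ge> 0"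
  shows "psd_on V B"
  using assms by (auto simp: psd_on_def)

lemma psd_on_sym: "psd_on V B \<Longrightarrow> i \<in> V \<Longrightarrow> j \<in> V \<Longrightarrow> B i j = B j i"
  by (auto simp: psd_on_def)

lemma psd_on_quad: "psd_on V B \<Longrightarrow> (\<Sum>i\<in>V. \<Sum>j\<in>V. x i * B i j * x j) \<ge> 0"
  by (auto simp: psd_on_def)

lemma psd_on_cong:
  assumes "\<And>i j. i \<in> V \<Longrightarrow> j \<in> V \<Longrightarrow> B i j = C i j"
  shows "psd_on V B \<longleftrightarrow> psd_on V C"
proof -
  have "(\<Sum>i\<in>V. \<Sum>j\<in>V. x i * B i j * x j) = (\<Sum>i\<in>V. \<Sum>j\<in>V. x i * C i j * x j)" for x :: "'a \<Rightarrow> real"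
    by (intro sum.cong refl) (simp add: assms)
  then show ?thesis
    using assms by (simp add: psd_on_def)
qed

lemma psd_on_add:
  assumes "psd_on V B" "psd_on V C"
  shows "psd_on V (\<lambda>i j. B i j + C i j)"
proof (rule psd_onI)
  fix x :: "'a \<Rightarrow> real"
  have "(\<Sum>i\<in>V. \<Sum>j\<in>V. x i * (B i j + C i j) * x j)
      = (\<Sum>i\<in>V. \<Sum>j\<in>V. x i * B i j * x j) + (\<Sum>i\<in>V. \<Sum>j\<in>V. x i * C i j * x j)"
    by (simp add: algebra_simps sum.distrib)
  then show "(\<Sum>i\<in>V. \<Sum>j\<in>V. x i * (B i j + C i j) * x j) \<ge> 0"
    using psd_on_quad[OF assms(1), of x] psd_on_quad[OF assms(2), of x] by simp
qed (simp add: psd_on_sym[OF assms(1)] psd_on_sym[OF assms(2)])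

lemma psd_on_scale:
  assumes "psd_on V B" "c \<ge> 0"
  shows "psd_on V (\<lambda>i j. c * B i j)"
proof (rule psd_onI)
  fix x :: "'a \<Rightarrow> real"
  have "(\<Sum>i\<in>V. \<Sum>j\<in>V. x i * (c * B i j) * x j) = c * (\<Sum>i\<in>V. \<Sum>j\<in>V. x i * B i j * x j)"
    by (simp add: sum_distrib_left mult_ac)
  then show "(\<Sum>i\<in>V. \<Sum>j\<in>V. x i * (c * B i j) * x j) \<ge> 0"
    using psd_on_quad[OF assms(1), of x] assms(2) by simp
qed (use assms psd_on_sym in fastforce)

lemma psd_on_rank1: "psd_on V (\<lambda>i j. u i * u j)"
proof (rule psd_onI)
  fix x :: "'a \<Rightarrow> real"
  have "(\<Sum>i\<in>V. \<Sum>j\<in>V. x i * (u i * u j) * x j) = (\<Sum>i\<in>V. x i * u i) * (\<Sum>j\<in>V. x j * u j)"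
    by (simp add: sum_product mult_ac)
  then show "(\<Sum>i\<in>V. \<Sum>j\<in>V. x i * (u i * u j) * x j) \<ge> 0"
    by simp
qed simp

lemma psd_on_one: "psd_on V (\<lambda>i j. 1)"
  using psd_on_rank1[of V "\<lambda>_. 1"] by simp

lemma psd_on_sum:
  assumes "\<And>f. f \<in> F \<Longrightarrow> psd_on V (B f)"
  shows "psd_on V (\<lambda>i j. \<Sum>f\<in>F. B f i j)"
proof (cases "finite F")
  case True
  then show ?thesis
    using assms
  proof (induction F rule: finite_induct)
    case empty
    then show ?case by (simp add: psd_on_def)
  next
    case (insert f F)
    then show ?case by (simp add: psd_on_add)
  qed
qed (simp add: psd_on_def)

lemma psd_on_subset:
  assumes "psd_on V B" "W \<subseteq> V" "finite V"
  shows "psd_on W B"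
proof (rule psd_onI)
  fix x :: "'a \<Rightarrow> real"
  let ?y = "\<lambda>i. if i \<in> W then x i else 0"
  have "(\<Sum>i\<in>V. \<Sum>j\<in>V. ?y i * B i j * ?y j) = (\<Sum>i\<in>V. \<Sum>j\<in>W. ?y i * B i j * ?y j)"
    by (intro sum.cong refl sum.mono_neutral_right) (use assms in auto)
  also have "\<dots> = (\<Sum>i\<in>W. \<Sum>j\<in>W. ?y i * B i j * ?y j)"
    by (intro sum.mono_neutral_right) (use assms in auto)
  also have "\<dots> = (\<Sum>i\<in>W. \<Sum>j\<in>W. x i * B i j * x j)"
    by (intro sum.cong refl) auto
  finally show "(\<Sum>i\<in>W. \<Sum>j\<in>W. x i * B i j * x j) \<ge> 0"
    using psd_on_quad[OF assms(1), of ?y] by simp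
qed (use assms psd_on_sym in fastforce)

lemma psd_on_reindex:
  assumes f: "bij_betw f V W" and B: "psd_on W B"
  shows "psd_on V (\<lambda>i j. B (f i) (f j))"
proof (rule psd_onI)
  fix x :: "'a \<Rightarrow> real"
  have inj: "inj_on f V" and W: "W = f ` V"
    using f by (auto simp: bij_betw_def)
  let ?y = "\<lambda>j. x (inv_into V f j)"
  have "(\<Sum>i\<in>W. \<Sum>j\<in>W. ?y i * B i j * ?y j) = (\<Sum>i\<in>V. \<Sum>j\<in>V. ?y (f i) * B (f i) (f j) * ?y (f j))"
    unfolding W by (simp add: sum.reindex[OF inj])
  also have "\<dots> = (\<Sum>i\<in>V. \<Sum>j\<in>V. x i * B (f i) (f j) * x j)"
    by (intro sum.cong refl) (simp add: inj)
  finally show "(\<Sum>i\<in>V. \<Sum>j\<in>V. x i * B (f i) (f j) * x j) \<ge> 0"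
    using psd_on_quad[OF B, of ?y] by simp
qed (use psd_on_sym[OF B] f in \<open>auto simp: bij_betw_def\<close>)

lemma psd_on_diag_nonneg:
  assumes "psd_on V B" "finite V" "a \<in> V"
  shows "B a a \<ge> 0"
  using psd_on_quad[OF psd_on_subset[OF assms(1) _ assms(2), of "{a}"], of "\<lambda>_. 1"] assms(3)
  by simp

lemma psd_on_two:
  assumes "psd_on V B" "finite V" "a \<in> V" "b \<in> V" "a \<noteq> b"
  shows "s\<^sup>2 * B a a + 2 * s * r * B a b + r\<^sup>2 * B b b \<ge> 0"
proof -
  have "psd_on {a, b} B"
    using assms by (intro psd_on_subset[OF assms(1)]) auto
  from psd_on_quad[OF this, of "\<lambda>i. if i = a then s else r"]
  have "0 \<le> s * B a a * s + s * B a b * r + (r * B b a * s + r * B b b * r)"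
    using assms(5) by simp
  then show ?thesis
    unfolding psd_on_sym[OF assms(1,4,3)] by (simp add: power2_eq_square mult_ac)
qed

text \<open>Weaker than the determinant bound, but linear in the diagonal: it can be summed against
  the trace, and a bound on the diagonal becomes a bound on all entries.\<close>

lemma psd_on_abs_le:
  assumes "psd_on V B" "finite V" "a \<in> V" "b \<in> V"
  shows "\<bar>B a b\<bar> \<le> (B a a + B b b) / 2"
proof (cases "a = b")
  case True
  then show ?thesis using psd_on_diag_nonneg[OF assms(1-3)] by simp
next
  case False
  from psd_on_two[OF assms False, of 1 1] psd_on_two[OF assms False, of 1 "-1"]
  show ?thesis by simp
qed

lemma psd_on_zero_diag:
  assumes "psd_on V B" "finite V" "a \<in> V" "b \<in> V" "B a a = 0"
  shows "B a b = 0"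
proof (cases "a = b")
  case False
  show ?thesis
  proof (rule ccontr)
    assume "B a b \<noteq> 0"
    \<comment> \<open>With \<open>B a a = 0\<close> the form is linear in the coordinate at
      \<open>a\<close>; this coordinate is chosen to make its value \<open>-1\<close>.\<close>
    moreover have "2 * (- (B b b + 1) / (2 * B a b)) * 1 * B a b + B b b \<ge> 0"
      using psd_on_two[OF assms(1-4) False, of "- (B b b + 1) / (2 * B a b)" 1] assms(5) by simp
    ultimately show False by (simp add: field_simps)
  qed
qed (use assms in simp)

text \<open>Cholesky factorisation: splitting off the row of \<open>a\<close> leaves the Schur
  complement, which is again psd. If the pivot \<open>c\<close> is 0, the whole row vanishes and
  division by zero makes \<open>w\<close> vanish too, so both cases run through the same
  formulas.\<close>

lemma psd_on_gram:
  assumes "finite V" "psd_on V Q"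
  shows "\<exists>v :: 'a \<Rightarrow> 'a \<Rightarrow> real. \<forall>i\<in>V. \<forall>j\<in>V. Q i j = (\<Sum>k\<in>V. v k i * v k j)"
  using assms
proof (induction V arbitrary: Q rule: finite_induct)
  case empty
  then show ?case by simp
next
  case (insert a V)
  define c where "c = Q a a"
  define w where "w i = Q a i / sqrt c" for i
  have c: "c \<ge> 0"
    unfolding c_def by (rule psd_on_diag_nonneg[OF insert.prems]) (use insert in auto)
  have w2: "w i * w j = Q a i * Q a j / c" for i j
    unfolding w_def using c by (cases "c = 0") simp_all
  have sym: "Q i a = Q a i" if "i \<in> V" for i
    using psd_on_sym[OF insert.prems, of i a] that by simp
  have row0: "Q a i = 0" if "c = 0" "i \<in> V" for i
    using psd_on_zero_diag[OF insert.prems] that insert.hyps unfolding c_def by simp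
  have "psd_on V (\<lambda>i j. Q i j - w i * w j)"
  proof (rule psd_onI)
    fix i j assume "i \<in> V" "j \<in> V"
    then show "Q i j - w i * w j = Q j i - w j * w i"
      using psd_on_sym[OF insert.prems, of i j] by simp
  next
    fix x :: "'a \<Rightarrow> real"
    define L where "L = (\<Sum>i\<in>V. Q a i * x i)"
    define R where "R = (\<Sum>i\<in>V. \<Sum>j\<in>V. x i * Q i j * x j)"
    \<comment> \<open>The coordinate at \<open>a\<close> that minimises the form for given
      \<open>x\<close> on \<open>V\<close>; the minimum is the form of the Schur complement. For
      \<open>c = 0\<close> it reads 0.\<close>
    let ?y = "x(a := - L / c)"
    have e1: "(\<Sum>j\<in>insert a V. ?y a * Q a j * ?y j) = (L / c)\<^sup>2 * c - L / c * L"
    proof -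
      have "(\<Sum>j\<in>V. ?y a * Q a j * ?y j) = - L / c * L"
        unfolding L_def sum_distrib_left using insert.hyps by (intro sum.cong) auto
      then show ?thesis
        using insert.hyps by (simp add: c_def power2_eq_square)
    qed
    have e2: "(\<Sum>j\<in>insert a V. ?y i * Q i j * ?y j) = x i * Q a i * (- L / c) + (\<Sum>j\<in>V. x i * Q i j * x j)"
      if "i \<in> V" for i
    proof -
      have "i \<noteq> a" using that insert.hyps by auto
      moreover have "(\<Sum>j\<in>V. ?y i * Q i j * ?y j) = (\<Sum>j\<in>V. x i * Q i j * x j)"
        using insert.hyps that by (intro sum.cong) auto
      ultimately show ?thesis
        using insert.hyps sym[OF that] by simp
    qed
    have e3: "(\<Sum>i\<in>V. x i * Q a i * (- L / c)) = - L / c * L"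
      unfolding L_def sum_distrib_left by (intro sum.cong) auto
    have "0 \<le> (\<Sum>i\<in>insert a V. \<Sum>j\<in>insert a V. ?y i * Q i j * ?y j)"
      by (rule psd_on_quad[OF insert.prems])
    also have "\<dots> = (\<Sum>j\<in>insert a V. ?y a * Q a j * ?y j) + (\<Sum>i\<in>V. \<Sum>j\<in>insert a V. ?y i * Q i j * ?y j)"
      using insert.hyps by (subst sum.insert) auto
    also have "\<dots> = ((L / c)\<^sup>2 * c - L / c * L) + (- L / c * L + R)"
    proof -
      have "(\<Sum>i\<in>V. \<Sum>j\<in>insert a V. ?y i * Q i j * ?y j)
          = (\<Sum>i\<in>V. x i * Q a i * (- L / c) + (\<Sum>j\<in>V. x i * Q i j * x j))"
        by (rule sum.cong[OF refl e2])
      then show ?thesis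
        unfolding e1 R_def by (simp only: sum.distrib e3)
    qed
    also have "\<dots> = R - L\<^sup>2 / c"
      by (cases "c = 0") (simp_all add: field_simps power2_eq_square)
    also have "\<dots> = (\<Sum>i\<in>V. \<Sum>j\<in>V. x i * (Q i j - w i * w j) * x j)"
      unfolding R_def L_def w2 power2_eq_square sum_product sum_divide_distrib
        sum_subtractf[symmetric]
      by (intro sum.cong refl) (simp add: algebra_simps)
    finally show "(\<Sum>i\<in>V. \<Sum>j\<in>V. x i * (Q i j - w i * w j) * x j) \<ge> 0" .
  qed
  from insert.IH[OF this] obtain v
    where v: "\<And>i j. i \<in> V \<Longrightarrow> j \<in> V \<Longrightarrow> Q i j - w i * w j = (\<Sum>k\<in>V. v k i * v k j)"
    by blast
  \<comment> \<open>Triangular shape: the new vector \<open>w\<close> takes the index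
    \<open>a\<close>, and the old vectors are extended by 0 at \<open>a\<close>.\<close>
  define u where "u k i = (if k = a then w i else if i = a then 0 else v k i)" for k i
  have eq: "(\<Sum>k\<in>insert a V. u k i * u k j) = w i * w j + (\<Sum>k\<in>V. u k i * u k j)" for i j
    using insert.hyps by (simp add: u_def)
  have wa: "w a * w j = Q a j" if "j \<in> insert a V" for j
    using row0[of j] that unfolding w2 by (cases "c = 0") (auto simp: c_def)
  have "Q i j = (\<Sum>k\<in>insert a V. u k i * u k j)" if ij: "i \<in> insert a V" "j \<in> insert a V" for i j
  proof -
    consider "i = a" | "j = a" "i \<in> V" | "i \<in> V" "j \<in> V" "i \<noteq> a" "j \<noteq> a"
      using ij insert.hyps by auto
    then show ?thesis
    proof cases
      case 1
      have "(\<Sum>k\<in>V. u k i * u k j) = 0"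
        using 1 insert.hyps by (intro sum.neutral) (auto simp: u_def)
      then show ?thesis using 1 wa[OF ij(2)] eq by simp
    next
      case 2
      have "(\<Sum>k\<in>V. u k i * u k j) = 0"
        using 2 insert.hyps by (intro sum.neutral) (auto simp: u_def)
      then show ?thesis using 2 wa[OF ij(1)] eq[of i j] sym by (simp add: mult.commute)
    next
      case 3
      have "(\<Sum>k\<in>V. u k i * u k j) = (\<Sum>k\<in>V. v k i * v k j)"
        using 3 insert.hyps by (intro sum.cong) (auto simp: u_def)
      then show ?thesis using eq[of i j] v[OF 3(1,2)] by simp
    qed
  qed
  then show ?case by blast
qed

text \<open>Self-duality of the psd cone, in the direction that yields weak duality: a Gram
  factorisation of \<open>A\<close> turns the trace inner product into a sum of values of the form
  of \<open>B\<close>.\<close>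

lemma psd_on_inner:
  assumes "finite V" "psd_on V A" "psd_on V B"
  shows "(\<Sum>i\<in>V. \<Sum>j\<in>V. A i j * B i j) \<ge> 0"
proof -
  obtain v where v: "\<And>i j. i \<in> V \<Longrightarrow> j \<in> V \<Longrightarrow> A i j = (\<Sum>k\<in>V. v k i * v k j)"
    using psd_on_gram[OF assms(1,2)] by metis
  have "(\<Sum>i\<in>V. \<Sum>j\<in>V. A i j * B i j) = (\<Sum>i\<in>V. \<Sum>j\<in>V. \<Sum>k\<in>V. v k i * B i j * v k j)"
    by (intro sum.cong refl) (simp add: v sum_distrib_left sum_distrib_right mult_ac)
  also have "\<dots> = (\<Sum>i\<in>V. \<Sum>k\<in>V. \<Sum>j\<in>V. v k i * B i j * v k j)"
    by (rule sum.cong[OF refl], rule sum.swap)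
  also have "\<dots> = (\<Sum>k\<in>V. \<Sum>i\<in>V. \<Sum>j\<in>V. v k i * B i j * v k j)"
    by (rule sum.swap)
  also have "\<dots> \<ge> 0"
    by (intro sum_nonneg psd_on_quad[OF assms(3)])
  finally show ?thesis .
qed

lemma psd_on_rank1_tensor:
  fixes u :: "'a \<Rightarrow> real" and B :: "'b \<Rightarrow> 'b \<Rightarrow> real"
  assumes "psd_on W B"
  shows "psd_on (V \<times> W) (\<lambda>p q. u (fst p) * u (fst q) * B (snd p) (snd q))"
proof (rule psd_onI)
  fix x :: "'a \<times> 'b \<Rightarrow> real"
  define y where "y k = (\<Sum>i\<in>V. u i * x (i, k))" for k
  have split: "(\<Sum>p\<in>V \<times> W. f p) = (\<Sum>k\<in>W. \<Sum>i\<in>V. f (i, k))" for f :: "'a \<times> 'b \<Rightarrow> real"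
    unfolding sum.cartesian_product' by (rule sum.swap)
  have "(\<Sum>p\<in>V \<times> W. \<Sum>q\<in>V \<times> W. x p * (u (fst p) * u (fst q) * B (snd p) (snd q)) * x q)
      = (\<Sum>k\<in>W. \<Sum>i\<in>V. \<Sum>l\<in>W. (u i * x (i, k)) * B k l * y l)"
    unfolding split y_def sum_distrib_left by (simp add: mult_ac)
  also have "\<dots> = (\<Sum>k\<in>W. \<Sum>l\<in>W. \<Sum>i\<in>V. (u i * x (i, k)) * B k l * y l)"
    by (rule sum.cong[OF refl], rule sum.swap)
  also have "\<dots> = (\<Sum>k\<in>W. \<Sum>l\<in>W. y k * B k l * y l)"
    unfolding y_def sum_distrib_right ..
  also have "\<dots> \<ge> 0"
    by (rule psd_on_quad[OF assms])
  finally show "(\<Sum>p\<in>V \<times> W. \<Sum>q\<in>V \<times> W. x p * (u (fst p) * u (fst q) * B (snd p) (snd q)) * x q) \<ge> 0" .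
qed (use assms psd_on_sym in fastforce)

text \<open>Factoring \<open>A\<close> alone is enough: for a rank-one \<open>A\<close> the first
  coordinate can be contracted away, which leaves a value of the form of \<open>B\<close>.\<close>

lemma psd_on_tensor:
  assumes "finite V" "psd_on V A" "psd_on W B"
  shows "psd_on (V \<times> W) (\<lambda>p q. A (fst p) (fst q) * B (snd p) (snd q))"
proof -
  obtain v where v: "\<And>i j. i \<in> V \<Longrightarrow> j \<in> V \<Longrightarrow> A i j = (\<Sum>m\<in>V. v m i * v m j)"
    using psd_on_gram[OF assms(1,2)] by metis
  have "psd_on (V \<times> W) (\<lambda>p q. \<Sum>m\<in>V. v m (fst p) * v m (fst q) * B (snd p) (snd q))"
    by (intro psd_on_sum psd_on_rank1_tensor assms(3))
  then show ?thesis
    by (rule psd_on_cong[THEN iffD1, rotated]) (auto simp: v sum_distrib_right)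
qed

section \<open>Dual certificates\<close>

lemma verts_complement [simp]: "verts (complement G) = verts G"
  by (simp add: complement_def)

lemma adj_complement:
  "adj (complement G) x y \<longleftrightarrow> x \<in> verts G \<and> y \<in> verts G \<and> x \<noteq> y \<and> \<not> adj G x y"
  by (simp add: complement_def)

lemma verts_strong_product [simp]: "verts (strong_product G H) = verts G \<times> verts H"
  by (simp add: strong_product_def)

lemma adj_strong_product:
  "adj (strong_product G H) p q \<longleftrightarrow> p \<in> verts G \<times> verts H \<and> q \<in> verts G \<times> verts H \<and> p \<noteq> q
     \<and> (fst p = fst q \<or> adj G (fst p) (fst q)) \<and> (snd p = snd q \<or> adj H (snd p) (snd q))"
  by (auto simp: strong_product_def split: prod.splits)

lemma verts_strong_power: "verts (strong_power G k) = {xs. set xs \<subseteq> verts G \<and> length xs = k}"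
  by (auto simp: strong_power_def)

lemma adj_strong_power:
  "adj (strong_power G k) xs ys \<longleftrightarrow> xs \<in> verts (strong_power G k) \<and> ys \<in> verts (strong_power G k)
     \<and> xs \<noteq> ys \<and> (\<forall>i<k. xs ! i = ys ! i \<or> adj G (xs ! i) (ys ! i))"
  by (auto simp: strong_power_def)

lemma finite_verts: "simple_graph G \<Longrightarrow> finite (verts G)"
  by (simp add: simple_graph_def)

lemma finite_strong_power: "finite (verts G) \<Longrightarrow> finite (verts (strong_power G k))"
  unfolding verts_strong_power by (rule finite_lists_length_eq)

lemma simple_graph_complement: "simple_graph G \<Longrightarrow> simple_graph (complement G)"
  by (auto simp: simple_graph_def adj_complement)

lemma simple_graph_strong_product:
  "simple_graph G \<Longrightarrow> simple_graph H \<Longrightarrow> simple_graph (strong_product G H)"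
  unfolding simple_graph_def adj_strong_product by auto

lemma finite_independent_sets: "finite (verts G) \<Longrightarrow> finite {S. independent_set G S}"
  by (rule finite_subset[of _ "Pow (verts G)"]) (auto simp: independent_set_def)

lemma card_le_independence_number:
  "finite (verts G) \<Longrightarrow> independent_set G S \<Longrightarrow> card S \<le> independence_number G"
  unfolding independence_number_def by (rule Max_ge) (auto intro: finite_independent_sets)

lemma independence_number_attained:
  assumes "finite (verts G)"
  obtains S where "independent_set G S" "card S = independence_number G"
proof -
  have "independent_set G {}"
    by (simp add: independent_set_def)
  then have "independence_number G \<in> card ` {S. independent_set G S}"
    unfolding independence_number_def
    by (intro Max_in finite_imageI finite_independent_sets assms) auto
  then show ?thesis
    using that by auto
qed

section \<open>The primal and the dual program of the theta function\<close>

definition theta_feasible :: "'a sgraph \<Rightarrow> ('a \<Rightarrow> 'a \<Rightarrow> real) \<Rightarrow> bool" where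
  "theta_feasible G B \<longleftrightarrow> psd_on (verts G) B \<and> (\<Sum>i\<in>verts G. B i i) = 1 \<and>
     (\<forall>i\<in>verts G. \<forall>j\<in>verts G. adj G i j \<longrightarrow> B i j = 0)"

text \<open>\<open>dual_feasible G t\<close> says that \<open>t\<close> is attained in the semidefinite program dual to the one
  defining the theta function.\<close>

definition dual_feasible :: "'a sgraph \<Rightarrow> real \<Rightarrow> bool" where
  "dual_feasible G t \<longleftrightarrow> (\<exists>M. psd_on (verts G) (\<lambda>i j. M i j - 1) \<and> (\<forall>i\<in>verts G. M i i = t) \<and>
     (\<forall>i\<in>verts G. \<forall>j\<in>verts G. i \<noteq> j \<longrightarrow> \<not> adj G i j \<longrightarrow> M i j = 0))"

lemma lovasz_theta_eq:
  "lovasz_theta G = Sup ((\<lambda>B. \<Sum>i\<in>verts G. \<Sum>j\<in>verts G. B i j) ` Collect (theta_feasible G))"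
  unfolding lovasz_theta_def theta_feasible_def by (rule arg_cong[of _ _ Sup]) auto

text \<open>Bounds the set under \<open>Sup\<close> in \<open>lovasz_theta\<close>, so that the
  supremum is meaningful.\<close>

lemma theta_feasible_sum_le_card:
  assumes "finite (verts G)" "theta_feasible G B"
  shows "(\<Sum>i\<in>verts G. \<Sum>j\<in>verts G. B i j) \<le> card (verts G)"
proof -
  have tr: "(\<Sum>i\<in>verts G. B i i) = 1" and psd: "psd_on (verts G) B"
    using assms(2) by (auto simp: theta_feasible_def)
  have "(\<Sum>i\<in>verts G. \<Sum>j\<in>verts G. B i j) \<le> (\<Sum>i\<in>verts G. \<Sum>j\<in>verts G. (B i i + B j j) / 2)"
    using psd_on_abs_le[OF psd assms(1)] by (intro sum_mono) (meson abs_le_D1)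
  also have "\<dots> = card (verts G)"
    by (simp add: sum.distrib sum_divide_distrib[symmetric] tr sum_distrib_left[symmetric])
  finally show ?thesis .
qed

lemma theta_feasible_sum_le_theta:
  assumes "finite (verts G)" "theta_feasible G B"
  shows "(\<Sum>i\<in>verts G. \<Sum>j\<in>verts G. B i j) \<le> lovasz_theta G"
  unfolding lovasz_theta_eq
  by (rule cSup_upper) (use assms theta_feasible_sum_le_card in \<open>auto intro!: bdd_aboveI2\<close>)

text \<open>These rank-one matrices put the independence number below the theta function. Applied to
  a single vertex they show that the set under \<open>Sup\<close> is nonempty.\<close>

lemma theta_feasible_indicator:
  assumes "finite (verts G)" "independent_set G S" "S \<noteq> {}"
  defines "B \<equiv> \<lambda>i j. of_bool (i \<in> S) * of_bool (j \<in> S) / real (card S)"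
  shows "theta_feasible G B" "(\<Sum>i\<in>verts G. \<Sum>j\<in>verts G. B i j) = card S"
proof -
  have S: "S \<subseteq> verts G" "finite S"
    using assms(1,2) by (auto simp: independent_set_def intro: finite_subset)
  have c: "(\<Sum>i\<in>verts G. of_bool (i \<in> S)) = real (card S)"
    using S assms(1) by (simp add: Int_absorb1 Collect_mem_eq flip: sum.inter_filter)
  have "psd_on (verts G) B"
    using psd_on_scale[OF psd_on_rank1[of "verts G" "\<lambda>i. of_bool (i \<in> S)"], of "1 / real (card S)"]
    by (simp add: B_def)
  moreover have "(\<Sum>i\<in>verts G. B i i) = 1"
    using S assms(3) by (simp add: B_def c flip: sum_divide_distrib of_bool_conj)
  ultimately show "theta_feasible G B"
    using assms(2) by (auto simp: theta_feasible_def independent_set_def B_def)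
  have "(\<Sum>i\<in>verts G. \<Sum>j\<in>verts G. B i j) = real (card S) * real (card S) / real (card S)"
    unfolding B_def c[symmetric] sum_product sum_divide_distrib ..
  then show "(\<Sum>i\<in>verts G. \<Sum>j\<in>verts G. B i j) = card S"
    by simp
qed

lemma independence_number_le_theta:
  assumes "simple_graph G" "verts G \<noteq> {}"
  shows "independence_number G \<le> lovasz_theta G"
proof -
  have fin: "finite (verts G)" using assms(1) by (rule finite_verts)
  obtain S where S: "independent_set G S" "card S = independence_number G"
    using independence_number_attained[OF fin] .
  obtain v where "v \<in> verts G" using assms(2) by auto
  then have "independent_set G {v}"
    using assms(1) by (auto simp: independent_set_def simple_graph_def)
  from card_le_independence_number[OF fin this] S have "S \<noteq> {}" by auto
  from theta_feasible_sum_le_theta[OF fin theta_feasible_indicator(1)[OF fin S(1) this]]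
  show ?thesis
    unfolding theta_feasible_indicator(2)[OF fin S(1) \<open>S \<noteq> {}\<close>] by (simp add: S(2))
qed

lemma one_le_theta:
  assumes "simple_graph G" "verts G \<noteq> {}"
  shows "1 \<le> lovasz_theta G"
proof -
  have fin: "finite (verts G)" using assms(1) by (rule finite_verts)
  obtain v where "v \<in> verts G" using assms(2) by auto
  then have v: "independent_set G {v}"
    using assms(1) by (auto simp: independent_set_def simple_graph_def)
  from theta_feasible_sum_le_theta[OF fin theta_feasible_indicator(1)[OF fin this]]
  show ?thesis
    unfolding theta_feasible_indicator(2)[OF fin v insert_not_empty] by simp
qed

lemma theta_le:
  assumes "simple_graph G" "verts G \<noteq> {}"
    and "\<And>B. theta_feasible G B \<Longrightarrow> (\<Sum>i\<in>verts G. \<Sum>j\<in>verts G. B i j) \<le> t"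
  shows "lovasz_theta G \<le> t"
proof -
  have fin: "finite (verts G)" using assms(1) by (rule finite_verts)
  obtain v where "v \<in> verts G" using assms(2) by auto
  then have "independent_set G {v}"
    using assms(1) by (auto simp: independent_set_def simple_graph_def)
  from theta_feasible_indicator(1)[OF fin this] have "Collect (theta_feasible G) \<noteq> {}"
    by auto
  then show ?thesis
    unfolding lovasz_theta_eq by (intro cSup_least) (use assms(3) in auto)
qed

text \<open>Weak duality: off the diagonal \<open>B\<close> and \<open>M\<close> have disjoint
  supports, so their inner product is \<open>t\<close> times the trace of \<open>B\<close>, and
  pairing \<open>B\<close> with the psd matrix \<open>M - J\<close> gives the bound.\<close>

lemma dual_feasible_theta_le:
  assumes "simple_graph G" "verts G \<noteq> {}" "dual_feasible G t"
  shows "lovasz_theta G \<le> t"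
proof (rule theta_le[OF assms(1,2)])
  fix B assume B: "theta_feasible G B"
  obtain M where M: "psd_on (verts G) (\<lambda>i j. M i j - 1)" "\<And>i. i \<in> verts G \<Longrightarrow> M i i = t"
    "\<And>i j. i \<in> verts G \<Longrightarrow> j \<in> verts G \<Longrightarrow> i \<noteq> j \<Longrightarrow> \<not> adj G i j \<Longrightarrow> M i j = 0"
    using assms(3) unfolding dual_feasible_def by metis
  have fin: "finite (verts G)" using assms(1) by (rule finite_verts)
  have BM: "B i j * M i j = (if i = j then t * B i i else 0)" if "i \<in> verts G" "j \<in> verts G" for i j
    using that B M(2,3) assms(1) unfolding theta_feasible_def simple_graph_def by (cases "adj G i j") auto
  have "0 \<le> (\<Sum>i\<in>verts G. \<Sum>j\<in>verts G. B i j * (M i j - 1))"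
    using B by (intro psd_on_inner[OF fin _ M(1)]) (simp add: theta_feasible_def)
  also have "\<dots> = (\<Sum>i\<in>verts G. \<Sum>j\<in>verts G. B i j * M i j) - (\<Sum>i\<in>verts G. \<Sum>j\<in>verts G. B i j)"
    by (simp add: algebra_simps sum_subtractf)
  also have "(\<Sum>i\<in>verts G. \<Sum>j\<in>verts G. B i j * M i j) = (\<Sum>i\<in>verts G. t * B i i)"
    using fin by (simp add: BM)
  also have "\<dots> = t"
    using B by (simp add: theta_feasible_def flip: sum_distrib_left)
  finally show "(\<Sum>i\<in>verts G. \<Sum>j\<in>verts G. B i j) \<le> t"
    by simp
qed

lemma dual_feasible_ge_one:
  assumes "finite (verts G)" "verts G \<noteq> {}" "dual_feasible G t"
  shows "t \<ge> 1"
proof -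
  obtain v where v: "v \<in> verts G" using assms(2) by auto
  obtain M where M: "psd_on (verts G) (\<lambda>i j. M i j - 1)" "\<And>i. i \<in> verts G \<Longrightarrow> M i i = t"
    using assms(3) unfolding dual_feasible_def by metis
  show ?thesis
    using psd_on_diag_nonneg[OF M(1) assms(1) v] M(2)[OF v] by simp
qed

text \<open>On an independent set \<open>M\<close> is \<open>t\<close> times the identity, and the
  all-ones vector tests \<open>M - J\<close> there. Avoiding \<open>lovasz_theta\<close> lets this
  apply to strong powers without first showing that they are simple graphs.\<close>

lemma dual_feasible_independence_number_le:
  assumes "finite (verts G)" "verts G \<noteq> {}" "dual_feasible G t" "\<And>x. \<not> adj G x x"
  shows "real (independence_number G) \<le> t"
proof -
  obtain S where S: "independent_set G S" "card S = independence_number G"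
    using independence_number_attained[OF assms(1)] .
  have SV: "S \<subseteq> verts G" and finS: "finite S"
    using S assms(1) by (auto simp: independent_set_def intro: finite_subset)
  obtain M where M: "psd_on (verts G) (\<lambda>i j. M i j - 1)" "\<And>i. i \<in> verts G \<Longrightarrow> M i i = t"
    "\<And>i j. i \<in> verts G \<Longrightarrow> j \<in> verts G \<Longrightarrow> i \<noteq> j \<Longrightarrow> \<not> adj G i j \<Longrightarrow> M i j = 0"
    using assms(3) unfolding dual_feasible_def by metis
  have MS: "M i j = (if i = j then t else 0)" if "i \<in> S" "j \<in> S" for i j
    using that S(1) SV M(2)[of i] M(3)[of i j] unfolding independent_set_def by (cases "i = j") auto
  have "0 \<le> (\<Sum>i\<in>S. \<Sum>j\<in>S. M i j - 1)"
    using psd_on_quad[OF psd_on_subset[OF M(1) SV assms(1)], of "\<lambda>_. 1"] by simp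
  also have "\<dots> = real (card S) * (t - real (card S))"
    using finS by (simp add: MS sum_subtractf algebra_simps)
  finally have *: "0 \<le> real (card S) * (t - real (card S))" .
  show ?thesis
  proof (cases "card S = 0")
    case True
    then show ?thesis using dual_feasible_ge_one[OF assms(1-3)] S(2) by simp
  next
    case False
    then show ?thesis using * S(2) by (simp add: zero_le_mult_iff)
  qed
qed

text \<open>\<open>n I - J\<close> is psd by Cauchy-Schwarz. This trivial certificate makes the
  supremum defining the capacity bounded.\<close>

lemma dual_feasible_card:
  assumes "finite (verts G)"
  shows "dual_feasible G (card (verts G))"
proof -
  let ?V = "verts G"
  let ?M = "\<lambda>i j. if i = j then real (card ?V) else 0"
  have "psd_on ?V (\<lambda>i j. ?M i j - 1)"
  proof (rule psd_onI)
    fix x :: "'a \<Rightarrow> real"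
    have "(\<Sum>i\<in>?V. \<Sum>j\<in>?V. x i * (?M i j - 1) * x j)
        = (\<Sum>i\<in>?V. \<Sum>j\<in>?V. (if i = j then real (card ?V) * (x i)\<^sup>2 else 0) - x i * x j)"
      by (intro sum.cong refl) (auto simp: algebra_simps power2_eq_square)
    also have "\<dots> = real (card ?V) * (\<Sum>i\<in>?V. (x i)\<^sup>2) - (\<Sum>i\<in>?V. \<Sum>j\<in>?V. x i * x j)"
      using assms by (simp add: sum_subtractf flip: sum_distrib_left)
    also have "(\<Sum>i\<in>?V. \<Sum>j\<in>?V. x i * x j) = (\<Sum>i\<in>?V. x i)\<^sup>2"
      unfolding power2_eq_square sum_product ..
    also have "real (card ?V) * (\<Sum>i\<in>?V. (x i)\<^sup>2) - (\<Sum>i\<in>?V. x i)\<^sup>2 \<ge> 0"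
      using sum_squared_le_sum_of_squares[of x ?V] by (simp add: mult.commute)
    finally show "(\<Sum>i\<in>?V. \<Sum>j\<in>?V. x i * (?M i j - 1) * x j) \<ge> 0" .
  qed auto
  then show ?thesis
    unfolding dual_feasible_def by (intro exI[of _ ?M]) auto
qed

lemma dual_feasible_strong_product:
  assumes "finite (verts G)" "finite (verts H)" "dual_feasible G s" "dual_feasible H t"
  shows "dual_feasible (strong_product G H) (s * t)"
proof -
  obtain M where M: "psd_on (verts G) (\<lambda>i j. M i j - 1)" "\<And>i. i \<in> verts G \<Longrightarrow> M i i = s"
    "\<And>i j. i \<in> verts G \<Longrightarrow> j \<in> verts G \<Longrightarrow> i \<noteq> j \<Longrightarrow> \<not> adj G i j \<Longrightarrow> M i j = 0"
    using assms(3) unfolding dual_feasible_def by metis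
  obtain N where N: "psd_on (verts H) (\<lambda>i j. N i j - 1)" "\<And>i. i \<in> verts H \<Longrightarrow> N i i = t"
    "\<And>i j. i \<in> verts H \<Longrightarrow> j \<in> verts H \<Longrightarrow> i \<noteq> j \<Longrightarrow> \<not> adj H i j \<Longrightarrow> N i j = 0"
    using assms(4) unfolding dual_feasible_def by metis
  let ?K = "\<lambda>p q. M (fst p) (fst q) * N (snd p) (snd q)"
  have "psd_on (verts H) N"
    using psd_on_add[OF N(1) psd_on_one] by simp
  \<comment> \<open>\<open>M \<otimes> N - J \<otimes> J = (M - J) \<otimes> N + J \<otimes> (N - J)\<close>\<close>
  from psd_on_add[OF psd_on_tensor[OF assms(1) M(1) this] psd_on_tensor[OF assms(1) psd_on_one N(1)]]
  have "psd_on (verts (strong_product G H)) (\<lambda>p q. ?K p q - 1)"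
    by (simp add: algebra_simps)
  \<comment> \<open>A distinct nonadjacent pair of the product is distinct and nonadjacent in some
    coordinate, and that factor vanishes.\<close>
  moreover have "?K p q = 0" if "p \<in> verts G \<times> verts H" "q \<in> verts G \<times> verts H" "p \<noteq> q"
    "\<not> adj (strong_product G H) p q" for p q
    using that M(3)[of "fst p" "fst q"] N(3)[of "snd p" "snd q"] unfolding adj_strong_product by auto
  ultimately show ?thesis
    unfolding dual_feasible_def by (intro exI[of _ ?K]) (auto simp: M(2) N(2))
qed

lemma dual_feasible_iso:
  assumes f: "bij_betw f (verts G) (verts H)"
    and adj: "\<And>x y. x \<in> verts G \<Longrightarrow> y \<in> verts G \<Longrightarrow> adj G x y \<longleftrightarrow> adj H (f x) (f y)"
    and "dual_feasible H t"
  shows "dual_feasible G t"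
proof -
  obtain M where M: "psd_on (verts H) (\<lambda>i j. M i j - 1)" "\<And>i. i \<in> verts H \<Longrightarrow> M i i = t"
    "\<And>i j. i \<in> verts H \<Longrightarrow> j \<in> verts H \<Longrightarrow> i \<noteq> j \<Longrightarrow> \<not> adj H i j \<Longrightarrow> M i j = 0"
    using assms(3) unfolding dual_feasible_def by metis
  let ?N = "\<lambda>i j. M (f i) (f j)"
  have in_H: "f x \<in> verts H" if "x \<in> verts G" for x
    using f that by (auto simp: bij_betw_def)
  have inj: "inj_on f (verts G)"
    using f by (auto simp: bij_betw_def)
  have "psd_on (verts G) (\<lambda>i j. ?N i j - 1)"
    by (rule psd_on_reindex[OF f M(1)])
  moreover have "?N i j = 0" if "i \<in> verts G" "j \<in> verts G" "i \<noteq> j" "\<not> adj G i j" for i j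
    using that in_H adj inj by (intro M(3)) (auto simp: inj_on_eq_iff)
  ultimately show ?thesis
    unfolding dual_feasible_def by (intro exI[of _ ?N]) (use M(2) in_H in auto)
qed

lemma dual_feasible_strong_power:
  assumes "finite (verts G)" "dual_feasible G t"
  shows "dual_feasible (strong_power G k) (t ^ k)"
proof (induction k)
  case 0
  \<comment> \<open>The zeroth power has the empty list as its only vertex, so the trivial
    certificate has value 1.\<close>
  then show ?case
    using dual_feasible_card[OF finite_strong_power[OF assms(1)], of 0]
    by (simp add: verts_strong_power conj_commute cong: conj_cong)
next
  case (Suc k)
  let ?f = "\<lambda>xs. (hd xs, tl xs)"
  have "bij_betw ?f (verts (strong_power G (Suc k))) (verts (strong_product G (strong_power G k)))"
    unfolding verts_strong_product verts_strong_power
    by (rule bij_betw_byWitness[where f' = "\<lambda>(x, xs). x # xs"])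
      (auto simp: length_Suc_conv)
  moreover have "adj (strong_power G (Suc k)) xs ys
      \<longleftrightarrow> adj (strong_product G (strong_power G k)) (?f xs) (?f ys)"
    if "xs \<in> verts (strong_power G (Suc k))" "ys \<in> verts (strong_power G (Suc k))" for xs ys
  proof -
    have "length xs = Suc k" "length ys = Suc k"
      using that by (simp_all add: verts_strong_power)
    then obtain x xs' y ys' where [simp]: "xs = x # xs'" "ys = y # ys'"
      by (metis length_Suc_conv)
    have len: "length xs' = k" "length ys' = k"
      using that by (auto simp: verts_strong_power)
    show ?thesis
      using that len
      by (auto simp: adj_strong_power adj_strong_product verts_strong_power All_less_Suc2 list_eq_iff_nth_eq)
  qed
  moreover have "dual_feasible (strong_product G (strong_power G k)) (t ^ Suc k)"
    using dual_feasible_strong_product[OF assms(1) finite_strong_power[OF assms(1)] assms(2) Suc]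
    by simp
  ultimately show ?case
    by (rule dual_feasible_iso)
qed

lemma root_independence_number_le:
  assumes "simple_graph G" "verts G \<noteq> {}" "dual_feasible G t" "k \<ge> 1"
  shows "root k (independence_number (strong_power G k)) \<le> t"
proof -
  have fin: "finite (verts G)" using assms(1) by (rule finite_verts)
  obtain v where "v \<in> verts G" using assms(2) by auto
  then have "replicate k v \<in> verts (strong_power G k)"
    by (auto simp: verts_strong_power)
  then have "independence_number (strong_power G k) \<le> t ^ k"
    by (intro dual_feasible_independence_number_le dual_feasible_strong_power finite_strong_power
        fin assms(3)) (auto simp: adj_strong_power)
  moreover have "t \<ge> 1"
    using dual_feasible_ge_one[OF fin assms(2,3)] .
  ultimately show ?thesis
    using assms(4) real_root_le_mono[of k "independence_number (strong_power G k)" "t ^ k"]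
    by (simp add: real_root_power_cancel)
qed

lemma shannon_capacity_le:
  assumes "simple_graph G" "verts G \<noteq> {}" "dual_feasible G t"
  shows "shannon_capacity G \<le> t"
  unfolding shannon_capacity_def
  by (rule cSUP_least) (use root_independence_number_le[OF assms] in auto)

lemma root_independence_number_le_shannon_capacity:
  assumes "simple_graph G" "verts G \<noteq> {}" "k \<ge> 1"
  shows "root k (independence_number (strong_power G k)) \<le> shannon_capacity G"
  unfolding shannon_capacity_def
  by (rule cSUP_upper)
    (use assms root_independence_number_le[OF assms(1,2) dual_feasible_card] finite_verts
      in \<open>auto intro!: bdd_aboveI2\<close>)

lemma independence_number_le_shannon_capacity:
  assumes "simple_graph G" "verts G \<noteq> {}"
  shows "independence_number G \<le> shannon_capacity G"
proof -
  have fin: "finite (verts G)" using assms(1) by (rule finite_verts)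
  obtain S where S: "independent_set G S" "card S = independence_number G"
    using independence_number_attained[OF fin] .
  have "independent_set (strong_power G 1) ((\<lambda>x. [x]) ` S)"
    using S(1) by (auto simp: independent_set_def adj_strong_power verts_strong_power)
  from card_le_independence_number[OF finite_strong_power[OF fin] this]
  have "independence_number G \<le> independence_number (strong_power G 1)"
    using S(2) by (simp add: card_image inj_on_def)
  then show ?thesis
    using root_independence_number_le_shannon_capacity[OF assms, of 1] by simp
qed

section \<open>Strong duality\<close>

text \<open>\<open>2 * a\<close> is the one-sided derivative at 0 of a squared distance along a
  segment that starts at a minimiser. Steps are limited to \<open>e \<le> 1\<close> because
  shrinking a psd matrix by the factor \<open>1 - e\<close> stays in the cone only that far.\<close>

lemma first_order_nonneg:
  fixes a b :: real
  assumes "\<And>e. 0 < e \<Longrightarrow> e \<le> 1 \<Longrightarrow> 0 \<le> 2 * e * a + e\<^sup>2 * b" and b: "b \<ge> 0"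
  shows "a \<ge> 0"
proof (rule ccontr)
  assume "\<not> a \<ge> 0"
  then have a: "a < 0" by simp
  \<comment> \<open>Small enough that \<open>e * b\<close> is at most \<open>- a\<close>, which
    leaves \<open>2 * a + e * b\<close> negative; the \<open>+ 1\<close> covers
    \<open>b = 0\<close>.\<close>
  define e where "e = min 1 (- a / (b + 1))"
  have e: "0 < e" "e \<le> 1" "e \<le> - a / (b + 1)"
    using a b by (auto simp: e_def intro!: divide_pos_pos divide_neg_pos)
  have "0 \<le> e * (2 * a + e * b)"
    using assms(1)[OF e(1,2)] by (simp add: power2_eq_square algebra_simps)
  then have "0 \<le> 2 * a + e * b"
    using e(1) by (simp add: zero_le_mult_iff)
  moreover have "e * (b + 1) \<le> - a"
    using e(3) b by (subst (asm) pos_le_divide_eq) simp_all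
  moreover have "e * b \<le> e * (b + 1)"
    using e by simp
  ultimately show False using a by linarith
qed

text \<open>Strong duality: minimise the squared distance from the shifted cone of psd matrices
  to the affine space of matrices with the prescribed diagonal and zeros. The residual
  \<open>D\<close> at a minimiser is itself psd with zeros on the edges, and if it did not vanish, then
  its normalisation would beat the optimum of the primal program.\<close>

lemma psd_closest_point:
  fixes V :: "'a set" and T :: "'a \<Rightarrow> 'a \<Rightarrow> real"
  assumes "finite V" and diag: "\<And>i. i \<in> V \<Longrightarrow> (i, i) \<in> E" and E: "E \<subseteq> V \<times> V"
  obtains Q where "psd_on V Q"
    "\<And>P. psd_on V P \<Longrightarrow> (\<Sum>(i, j)\<in>E. (Q i j - T i j)\<^sup>2) \<le> (\<Sum>(i, j)\<in>E. (P i j - T i j)\<^sup>2)"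
proof -
  define f where "f Q = (\<Sum>p\<in>E. (Q p - T (fst p) (snd p))\<^sup>2)" for Q :: "'a \<times> 'a \<Rightarrow> real"
  have finE: "finite E" using assms finite_subset by blast
  \<comment> \<open>Bounds the diagonal of every competitor at least as good as the zero matrix: a
    single diagonal deviation has square at most \<open>f 0\<close>, hence at most
    \<open>(f 0 + 1)\<^sup>2\<close>. All entries are then bounded by
    \<open>psd_on_abs_le\<close>.\<close>
  define c where "c = f (\<lambda>_. 0) + 1 + (\<Sum>p\<in>E. \<bar>T (fst p) (snd p)\<bar>)"
  \<comment> \<open>Matrices are functions on all pairs, so that this box is compact by Tychonoff's
    theorem.\<close>
  define K where "K = PiE UNIV (\<lambda>_ :: 'a \<times> 'a. {-c..c})"
  define C where "C = {Q. psd_on V (curry Q)}"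
  have f_nonneg: "f Q \<ge> 0" for Q
    unfolding f_def by (intro sum_nonneg) simp
  have c: "c \<ge> 0"
    unfolding c_def using f_nonneg[of "\<lambda>_. 0"] by (intro add_nonneg_nonneg sum_nonneg) auto
  have cont: "continuous_on UNIV (\<lambda>Q :: 'a \<times> 'a \<Rightarrow> real. Q p)" for p
    by simp
  have "compact K"
    using compactin_PiE[of "\<lambda>_. euclidean" UNIV "\<lambda>_ :: 'a \<times> 'a. {-c..c}"]
    by (simp add: K_def euclidean_product_topology)
  moreover have "closed C"
  proof -
    have "C = (\<Inter>i\<in>V. \<Inter>j\<in>V. {Q. Q (i, j) = Q (j, i)})
        \<inter> (\<Inter>x. {Q. 0 \<le> (\<Sum>i\<in>V. \<Sum>j\<in>V. x i * Q (i, j) * x j)})"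
      unfolding C_def psd_on_def by auto
    moreover have "closed {Q :: 'a \<times> 'a \<Rightarrow> real. Q p = Q q}" for p q
      by (intro closed_Collect_eq cont)
    moreover have "closed {Q :: 'a \<times> 'a \<Rightarrow> real. 0 \<le> (\<Sum>i\<in>V. \<Sum>j\<in>V. x i * Q (i, j) * x j)}" for x
      by (intro closed_Collect_le continuous_on_const continuous_on_sum continuous_on_mult cont)
    ultimately show ?thesis
      by (simp only:) (intro closed_Int closed_INT ballI)
  qed
  ultimately have "compact (K \<inter> C)"
    by (rule compact_Int_closed)
  moreover have zero: "(\<lambda>_. 0) \<in> K \<inter> C"
    using c by (auto simp: K_def C_def psd_on_def)
  moreover have "continuous_on (K \<inter> C) f"
    unfolding f_def by (intro continuous_intros continuous_on_subset[OF cont]) auto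
  ultimately obtain Q where Q: "Q \<in> K \<inter> C" "\<And>P. P \<in> K \<inter> C \<Longrightarrow> f Q \<le> f P"
    using continuous_attains_inf[of "K \<inter> C" f] by auto
  have "f Q \<le> f (case_prod P)" if P: "psd_on V P" for P
  proof (cases "f (case_prod P) \<le> f (\<lambda>_. 0)")
    case False
    then show ?thesis using Q(2)[OF zero] by simp
  next
    case True
    \<comment> \<open>Clearing the entries outside \<open>V \<times> V\<close> puts the competitor
      into the box and changes neither its form on \<open>V\<close> nor its distance.\<close>
    define R where "R p = (if p \<in> V \<times> V then case_prod P p else 0)" for p
    have diag_le: "P i i \<le> c" if "i \<in> V" for i
    proof -
      have iE: "(i, i) \<in> E" using diag that .
      have "(P i i - T i i)\<^sup>2 \<le> f (case_prod P)"
        unfolding f_def using member_le_sum[OF iE, of "\<lambda>p. (case_prod P p - T (fst p) (snd p))\<^sup>2"] finE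
        by simp
      also have "\<dots> \<le> f (\<lambda>_. 0)" by (rule True)
      also have "\<dots> \<le> (f (\<lambda>_. 0) + 1)\<^sup>2"
        using f_nonneg[of "\<lambda>_. 0"] by (simp add: power2_eq_square algebra_simps)
      finally have "P i i - T i i \<le> f (\<lambda>_. 0) + 1"
        by (rule power2_le_imp_le) (use f_nonneg[of "\<lambda>_. 0"] in simp)
      moreover have "T i i \<le> (\<Sum>p\<in>E. \<bar>T (fst p) (snd p)\<bar>)"
        using member_le_sum[OF iE, of "\<lambda>p. \<bar>T (fst p) (snd p)\<bar>"] finE by simp
      ultimately show ?thesis unfolding c_def by simp
    qed
    have "\<bar>R p\<bar> \<le> c" for p
    proof (cases "p \<in> V \<times> V")
      case True
      then have "fst p \<in> V" "snd p \<in> V" by auto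
      with psd_on_abs_le[OF P assms(1) this] diag_le[of "fst p"] diag_le[of "snd p"] True
      show ?thesis by (simp add: R_def case_prod_beta)
    qed (use c in \<open>auto simp: R_def\<close>)
    then have "R \<in> K"
      by (simp add: K_def PiE_UNIV_domain abs_le_iff minus_le_iff)
    moreover have "R \<in> C"
      unfolding C_def using P by (simp add: R_def curry_def cong: psd_on_cong)
    ultimately have "f Q \<le> f R"
      using Q(2) by auto
    also have "f R = f (case_prod P)"
      unfolding f_def using E by (intro sum.cong) (auto simp: R_def)
    finally show ?thesis .
  qed
  then show ?thesis
    using that[of "curry Q"] Q(1) by (simp add: C_def f_def case_prod_beta)
qed

text \<open>The variational inequalities of a projection onto a cone. Adding a psd \<open>P\<close>
  to \<open>Q\<close> cannot decrease the distance, so \<open>D\<close> has nonnegative inner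
  product with every psd matrix; rank-one \<open>P\<close> then show that \<open>D\<close> is psd.
  Shrinking \<open>Q\<close> makes the inner product of \<open>D\<close> and \<open>Q\<close>
  nonpositive, which gives the bound on the squared norm of \<open>D = Q - T\<close>.\<close>

lemma psd_residual:
  fixes V :: "'a set" and T :: "'a \<Rightarrow> 'a \<Rightarrow> real"
  assumes "finite V" "\<And>i. i \<in> V \<Longrightarrow> (i, i) \<in> E" "E \<subseteq> V \<times> V"
    and sym: "\<And>i j. (i, j) \<in> E \<Longrightarrow> (j, i) \<in> E" "\<And>i j. T i j = T j i"
  shows "\<exists>Q D. psd_on V Q \<and> psd_on V D \<and>
    (\<forall>i j. D i j = (if (i, j) \<in> E then Q i j - T i j else 0)) \<and>
    (\<Sum>(i, j)\<in>E. (D i j)\<^sup>2) \<le> - (\<Sum>(i, j)\<in>E. D i j * T i j)"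
proof -
  obtain Q where Q: "psd_on V Q"
    "\<And>P. psd_on V P \<Longrightarrow> (\<Sum>(i, j)\<in>E. (Q i j - T i j)\<^sup>2) \<le> (\<Sum>(i, j)\<in>E. (P i j - T i j)\<^sup>2)"
    using psd_closest_point[OF assms(1-3), where T = T] by blast
  define D where "D i j = (if (i, j) \<in> E then Q i j - T i j else 0)" for i j
  have expand: "(\<Sum>(i, j)\<in>E. (Q i j + e * P i j - T i j)\<^sup>2)
      = (\<Sum>(i, j)\<in>E. (Q i j - T i j)\<^sup>2) + (2 * e * (\<Sum>(i, j)\<in>E. D i j * P i j)
        + e\<^sup>2 * (\<Sum>(i, j)\<in>E. (P i j)\<^sup>2))" for e P
    unfolding sum_distrib_left sum.distrib[symmetric]
    by (intro sum.cong refl) (auto simp: D_def power2_eq_square algebra_simps)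
  have sq: "(\<Sum>(i, j)\<in>E. (P i j)\<^sup>2) \<ge> 0" for P :: "'a \<Rightarrow> 'a \<Rightarrow> real"
    by (intro sum_nonneg) auto
  have D_nonneg: "(\<Sum>(i, j)\<in>E. D i j * P i j) \<ge> 0" if "psd_on V P" for P
  proof (rule first_order_nonneg[OF _ sq[of P]])
    fix e :: real assume "0 < e"
    then have "psd_on V (\<lambda>i j. Q i j + e * P i j)"
      using psd_on_add[OF Q(1) psd_on_scale[OF that]] by simp
    from Q(2)[OF this] show "0 \<le> 2 * e * (\<Sum>(i, j)\<in>E. D i j * P i j) + e\<^sup>2 * (\<Sum>(i, j)\<in>E. (P i j)\<^sup>2)"
      unfolding expand by simp
  qed
  have "- (\<Sum>(i, j)\<in>E. D i j * Q i j) \<ge> 0"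
  proof (rule first_order_nonneg[OF _ sq[of Q]])
    fix e :: real assume "0 < e" "e \<le> 1"
    then have "psd_on V (\<lambda>i j. Q i j + (- e) * Q i j)"
      using psd_on_scale[OF Q(1), of "1 - e"] by (simp add: algebra_simps)
    from Q(2)[OF this] show "0 \<le> 2 * e * - (\<Sum>(i, j)\<in>E. D i j * Q i j) + e\<^sup>2 * (\<Sum>(i, j)\<in>E. (Q i j)\<^sup>2)"
      unfolding expand by simp
  qed
  moreover have "(\<Sum>(i, j)\<in>E. (D i j)\<^sup>2) = (\<Sum>(i, j)\<in>E. D i j * Q i j) - (\<Sum>(i, j)\<in>E. D i j * T i j)"
    unfolding sum_subtractf[symmetric]
    by (intro sum.cong refl) (auto simp: D_def power2_eq_square algebra_simps)
  ultimately have "(\<Sum>(i, j)\<in>E. (D i j)\<^sup>2) \<le> - (\<Sum>(i, j)\<in>E. D i j * T i j)"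
    by linarith
  moreover have "psd_on V D"
  proof (rule psd_onI)
    fix i j assume "i \<in> V" "j \<in> V"
    then have "Q i j = Q j i" "(i, j) \<in> E \<longleftrightarrow> (j, i) \<in> E"
      using sym(1) psd_on_sym[OF Q(1)] by blast+
    then show "D i j = D j i"
      unfolding D_def by (simp only: sym(2)[of i j])
  next
    fix x :: "'a \<Rightarrow> real"
    have "(\<Sum>i\<in>V. \<Sum>j\<in>V. x i * D i j * x j) = (\<Sum>(i, j)\<in>V \<times> V. x i * D i j * x j)"
      by (simp add: sum.cartesian_product)
    also have "\<dots> = (\<Sum>(i, j)\<in>E. D i j * (x i * x j))"
      by (rule sum.mono_neutral_cong_right) (use assms in \<open>auto simp: D_def\<close>)
    also have "\<dots> \<ge> 0"
      by (rule D_nonneg[OF psd_on_rank1])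
    finally show "(\<Sum>i\<in>V. \<Sum>j\<in>V. x i * D i j * x j) \<ge> 0" .
  qed
  ultimately show ?thesis
    using Q(1) D_def by blast
qed

theorem dual_feasible_theta:
  assumes G: "simple_graph G"
  shows "dual_feasible G (lovasz_theta G)"
proof -
  let ?V = "verts G"
  let ?s = "lovasz_theta G"
  \<comment> \<open>\<open>E\<close> holds the entries that a certificate prescribes, and on it
    \<open>T\<close> is the required value of \<open>M - J\<close>. Adjacent pairs are free in
    \<open>M\<close>; being outside \<open>E\<close>, they carry the zeros of \<open>D\<close> that
    primal feasibility demands.\<close>
  define E where "E = {(i, j). i \<in> ?V \<and> j \<in> ?V \<and> \<not> adj G i j}"
  define T where "T i j = (if i = j then ?s else 0) - 1" for i j :: 'a
  have fin: "finite ?V" using G by (rule finite_verts)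
  have E: "\<And>i. i \<in> ?V \<Longrightarrow> (i, i) \<in> E" "E \<subseteq> ?V \<times> ?V" "\<And>i j. (i, j) \<in> E \<Longrightarrow> (j, i) \<in> E"
    using G by (auto simp: E_def simple_graph_def)
  have T_sym: "\<And>i j. T i j = T j i"
    by (simp add: T_def)
  obtain Q D where Q: "psd_on ?V Q" and D: "psd_on ?V D"
    and DE: "\<And>i j. D i j = (if (i, j) \<in> E then Q i j - T i j else 0)"
    and D2: "(\<Sum>(i, j)\<in>E. (D i j)\<^sup>2) \<le> - (\<Sum>(i, j)\<in>E. D i j * T i j)"
    using psd_residual[of ?V E T, OF fin E T_sym] by blast
  have E_sum: "(\<Sum>(i, j)\<in>E. g i j * D i j) = (\<Sum>i\<in>?V. \<Sum>j\<in>?V. g i j * D i j)" for g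
    unfolding sum.cartesian_product
    by (rule sum.mono_neutral_left) (use E(2) fin DE in auto)
  let ?tr = "\<Sum>i\<in>?V. D i i"
  have tr: "?tr \<ge> 0"
    using psd_on_diag_nonneg[OF D fin] by (intro sum_nonneg) auto
  have "(\<Sum>(i, j)\<in>E. D i j * T i j) = (\<Sum>i\<in>?V. \<Sum>j\<in>?V. T i j * D i j)"
    using E_sum[of T] by (simp add: mult.commute)
  also have "\<dots> = (\<Sum>i\<in>?V. \<Sum>j\<in>?V. (if i = j then ?s * D i i else 0) - D i j)"
    by (intro sum.cong refl) (auto simp: T_def algebra_simps)
  also have "\<dots> = ?s * ?tr - (\<Sum>i\<in>?V. \<Sum>j\<in>?V. D i j)"
    using fin by (simp add: sum_subtractf sum_distrib_left)
  finally have D2': "(\<Sum>(i, j)\<in>E. (D i j)\<^sup>2) \<le> (\<Sum>i\<in>?V. \<Sum>j\<in>?V. D i j) - ?s * ?tr"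
    using D2 by simp
  have "(\<Sum>i\<in>?V. \<Sum>j\<in>?V. D i j) \<le> ?s * ?tr"
  proof (cases "?tr = 0")
    case True
    then have "D i i = 0" if "i \<in> ?V" for i
      using that psd_on_diag_nonneg[OF D fin] fin by (simp add: sum_nonneg_eq_0_iff)
    then have "D i j = 0" if "i \<in> ?V" "j \<in> ?V" for i j
      using psd_on_zero_diag[OF D fin] that by blast
    then show ?thesis using True by simp
  next
    case False
    with tr have tr: "?tr > 0" by simp
    have "theta_feasible G (\<lambda>i j. (1 / ?tr) * D i j)"
      unfolding theta_feasible_def
      using psd_on_scale[OF D, of "1 / ?tr"] tr DE by (auto simp: E_def simp flip: sum_divide_distrib)
    from theta_feasible_sum_le_theta[OF fin this] have "(\<Sum>i\<in>?V. \<Sum>j\<in>?V. D i j) / ?tr \<le> ?s"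
      by (simp add: sum_divide_distrib)
    then show ?thesis using tr by (simp add: pos_divide_le_eq)
  qed
  with D2' have "(\<Sum>(i, j)\<in>E. (D i j)\<^sup>2) \<le> 0"
    by simp
  moreover have "finite E" using E(2) fin finite_subset by blast
  ultimately have "(\<lambda>(i, j). (D i j)\<^sup>2) p \<le> 0" if "p \<in> E" for p
    using that by (intro order.trans[OF member_le_sum[of p E "\<lambda>(i, j). (D i j)\<^sup>2"]]) auto
  then have "D i j = 0" if "(i, j) \<in> E" for i j
    using that by fastforce
  with DE have "Q i j + 1 = (if i = j then ?s else 0)" if "(i, j) \<in> E" for i j
    using that by (simp add: T_def)
  then show ?thesis
    unfolding dual_feasible_def using Q E(1) by (intro exI[of _ "\<lambda>i j. Q i j + 1"]) (auto simp: E_def)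
qed

section \<open>Vertex-transitive graphs\<close>

text \<open>The all-ones vector is an eigenvector of \<open>B\<close> with eigenvalue
  \<open>r\<close>, and the subtraction lowers this eigenvalue to 0 without touching the orthogonal
  complement. Concretely, the new form at \<open>x\<close> is the form of \<open>B\<close> at
  \<open>x\<close> minus its mean.\<close>

lemma psd_on_minus_const:
  assumes "finite V" "V \<noteq> {}" "psd_on V B" and rows: "\<And>i. i \<in> V \<Longrightarrow> (\<Sum>j\<in>V. B i j) = r"
  shows "psd_on V (\<lambda>i j. B i j - r / card V)"
proof (rule psd_onI)
  fix x :: "'a \<Rightarrow> real"
  define c where "c = (\<Sum>i\<in>V. x i) / card V"
  have n: "real (card V) > 0" using assms(1,2) by (simp add: card_gt_0_iff)
  have sum_x: "(\<Sum>i\<in>V. x i) = card V * c" using n by (simp add: c_def)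
  have s1: "(\<Sum>i\<in>V. \<Sum>j\<in>V. x i * B i j) = r * (card V * c)"
    unfolding sum_x[symmetric] by (simp add: rows mult.commute flip: sum_distrib_left sum_distrib_right)
  have s2: "(\<Sum>i\<in>V. \<Sum>j\<in>V. B i j * x j) = r * (card V * c)"
  proof -
    have "(\<Sum>i\<in>V. \<Sum>j\<in>V. B i j * x j) = (\<Sum>j\<in>V. \<Sum>i\<in>V. B i j * x j)"
      by (rule sum.swap)
    also have "\<dots> = (\<Sum>j\<in>V. \<Sum>i\<in>V. x j * B j i)"
      by (intro sum.cong refl) (simp add: psd_on_sym[OF assms(3)] mult.commute)
    finally show ?thesis using s1 by simp
  qed
  have "0 \<le> (\<Sum>i\<in>V. \<Sum>j\<in>V. (x i - c) * B i j * (x j - c))"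
    by (rule psd_on_quad[OF assms(3)])
  also have "\<dots> = (\<Sum>i\<in>V. \<Sum>j\<in>V. x i * B i j * x j - c * (x i * B i j) - c * (B i j * x j) + c\<^sup>2 * B i j)"
    by (simp add: algebra_simps power2_eq_square)
  also have "\<dots> = (\<Sum>i\<in>V. \<Sum>j\<in>V. x i * B i j * x j) - c * (r * (card V * c)) - c * (r * (card V * c))
      + c\<^sup>2 * (card V * r)"
  proof -
    have "(\<Sum>i\<in>V. \<Sum>j\<in>V. x i * B i j * x j - c * (x i * B i j) - c * (B i j * x j) + c\<^sup>2 * B i j)
        = (\<Sum>i\<in>V. \<Sum>j\<in>V. x i * B i j * x j) - c * (\<Sum>i\<in>V. \<Sum>j\<in>V. x i * B i j)
          - c * (\<Sum>i\<in>V. \<Sum>j\<in>V. B i j * x j) + c\<^sup>2 * (\<Sum>i\<in>V. \<Sum>j\<in>V. B i j)"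
      by (simp add: sum.distrib sum_subtractf sum_distrib_left)
    then show ?thesis
      unfolding s1 s2 by (simp add: rows)
  qed
  also have "\<dots> = (\<Sum>i\<in>V. \<Sum>j\<in>V. x i * B i j * x j) - r / card V * (\<Sum>i\<in>V. \<Sum>j\<in>V. x i * x j)"
    using n unfolding sum_product[symmetric] sum_x by (simp add: power2_eq_square)
  also have "\<dots> = (\<Sum>i\<in>V. \<Sum>j\<in>V. x i * (B i j - r / card V) * x j)"
    unfolding sum_distrib_left sum_subtractf[symmetric]
    by (intro sum.cong refl) (simp add: algebra_simps)
  finally show "(\<Sum>i\<in>V. \<Sum>j\<in>V. x i * (B i j - r / card V) * x j) \<ge> 0" .
qed (simp add: psd_on_sym[OF assms(3)])

text \<open>An automorphism is arbitrary outside the vertex set; fixing it there leaves finitely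
  many functions to average over.\<close>

lemma automorphism_permutes:
  assumes "automorphism G f"
  obtains g where "automorphism G g" "g permutes verts G" "\<And>x. x \<in> verts G \<Longrightarrow> g x = f x"
proof
  let ?g = "\<lambda>x. if x \<in> verts G then f x else x"
  have "bij_betw ?g (verts G) (verts G) \<longleftrightarrow> bij_betw f (verts G) (verts G)"
    by (rule bij_betw_cong) simp
  with assms show "automorphism G ?g"
    by (auto simp: automorphism_def)
  then show "?g permutes verts G"
    by (intro bij_imp_permutes) (auto simp: automorphism_def)
qed simp

text \<open>Each automorphism preserves feasibility and the objective, hence so does the mean over
  all of them. The mean is invariant, and transitivity makes its diagonal and its row sums constant;
  the row sums are what \<open>psd_on_minus_const\<close> asks for.\<close>

lemma theta_feasible_average:
  assumes G: "simple_graph G" "verts G \<noteq> {}" and vt: "vertex_transitive G" and B: "theta_feasible G B"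
  defines "n \<equiv> real (card (verts G))"
  obtains B' where "theta_feasible G B'"
    "\<And>i. i \<in> verts G \<Longrightarrow> B' i i = 1 / n"
    "\<And>i. i \<in> verts G \<Longrightarrow> (\<Sum>j\<in>verts G. B' i j) = (\<Sum>i\<in>verts G. \<Sum>j\<in>verts G. B i j) / n"
proof -
  let ?V = "verts G"
  define A where "A = {f. f permutes ?V \<and> automorphism G f}"
  define B' where "B' i j = (1 / real (card A)) * (\<Sum>f\<in>A. B (f i) (f j))" for i j
  have fin: "finite ?V" using G(1) by (rule finite_verts)
  have n: "n > 0" using G fin by (simp add: n_def card_gt_0_iff)
  have finA: "finite A"
    by (rule finite_subset[OF _ finite_permutations[OF fin]]) (auto simp: A_def)
  moreover have "id \<in> A"
    by (auto simp: A_def automorphism_def permutes_id)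
  ultimately have cardA: "real (card A) > 0"
    by (auto simp: card_gt_0_iff)
  have bij: "bij_betw f ?V ?V" if "f \<in> A" for f
    using that by (simp add: A_def automorphism_def)
  have in_V: "f i \<in> ?V" if "f \<in> A" "i \<in> ?V" for f i
    using bij[OF that(1)] that(2) by (auto simp: bij_betw_def)
  have inv: "B' (g i) (g j) = B' i j" if g: "g \<in> A" for g i j
  proof -
    \<comment> \<open>Right translation by \<open>g\<close> permutes \<open>A\<close>: it is an
      injective self-map of a finite set, so no inverses in \<open>A\<close> have to be
      constructed.\<close>
    have "inj_on (\<lambda>f. f \<circ> g) A"
      using g permutes_surj[of g ?V] by (auto intro!: inj_onI simp: A_def fun_eq_iff) (metis surjD)
    moreover have "f \<circ> g \<in> A" if f: "f \<in> A" for f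
    proof -
      have "adj G x y \<longleftrightarrow> adj G (f (g x)) (f (g y))" if "x \<in> ?V" "y \<in> ?V" for x y
        using in_V[OF g that(1)] in_V[OF g that(2)] f g that unfolding A_def automorphism_def by blast
      then show ?thesis
        using f g bij_betw_trans[OF bij[OF g] bij[OF f]]
        by (simp add: A_def automorphism_def permutes_compose)
    qed
    ultimately have "bij_betw (\<lambda>f. f \<circ> g) A A"
      unfolding bij_betw_def by (intro conjI endo_inj_surj finA) auto
    from sum.reindex_bij_betw[OF this, of "\<lambda>f. B (f i) (f j)"] show ?thesis
      by (simp add: B'_def)
  qed
  have psd: "psd_on ?V B'"
    unfolding B'_def using B
    by (intro psd_on_scale psd_on_sum) (auto simp: theta_feasible_def intro: psd_on_reindex bij)
  have total: "(\<Sum>i\<in>?V. \<Sum>j\<in>?V. B' i j) = (\<Sum>i\<in>?V. \<Sum>j\<in>?V. B i j)"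
  proof -
    have "(\<Sum>i\<in>?V. \<Sum>j\<in>?V. \<Sum>f\<in>A. B (f i) (f j)) = (\<Sum>i\<in>?V. \<Sum>f\<in>A. \<Sum>j\<in>?V. B (f i) (f j))"
      by (rule sum.cong[OF refl], rule sum.swap)
    also have "\<dots> = (\<Sum>f\<in>A. \<Sum>i\<in>?V. \<Sum>j\<in>?V. B (f i) (f j))"
      by (rule sum.swap)
    also have "\<dots> = (\<Sum>f\<in>A. \<Sum>i\<in>?V. \<Sum>j\<in>?V. B i j)"
    proof (rule sum.cong[OF refl])
      fix f assume f: "f \<in> A"
      have "(\<Sum>i\<in>?V. \<Sum>j\<in>?V. B (f i) (f j)) = (\<Sum>i\<in>?V. \<Sum>j\<in>?V. B (f i) j)"
        by (rule sum.cong[OF refl], rule sum.reindex_bij_betw[OF bij[OF f]])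
      also have "\<dots> = (\<Sum>i\<in>?V. \<Sum>j\<in>?V. B i j)"
        by (rule sum.reindex_bij_betw[OF bij[OF f]])
      finally show "(\<Sum>i\<in>?V. \<Sum>j\<in>?V. B (f i) (f j)) = (\<Sum>i\<in>?V. \<Sum>j\<in>?V. B i j)" .
    qed
    finally show ?thesis
      using cardA by (simp add: B'_def flip: sum_divide_distrib)
  qed
  have trace: "(\<Sum>i\<in>?V. B' i i) = 1"
  proof -
    have "(\<Sum>i\<in>?V. \<Sum>f\<in>A. B (f i) (f i)) = (\<Sum>f\<in>A. \<Sum>i\<in>?V. B (f i) (f i))"
      by (rule sum.swap)
    also have "\<dots> = (\<Sum>f\<in>A. \<Sum>i\<in>?V. B i i)"
      by (rule sum.cong[OF refl], rule sum.reindex_bij_betw[OF bij])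
    also have "\<dots> = real (card A)"
      using B by (simp add: theta_feasible_def)
    finally show ?thesis
      using cardA by (simp add: B'_def flip: sum_divide_distrib)
  qed
  have zero: "B' i j = 0" if "i \<in> ?V" "j \<in> ?V" "adj G i j" for i j
  proof -
    have "B (f i) (f j) = 0" if f: "f \<in> A" for f
    proof -
      have "adj G (f i) (f j)"
        using f \<open>i \<in> ?V\<close> \<open>j \<in> ?V\<close> \<open>adj G i j\<close> unfolding A_def automorphism_def by blast
      then show ?thesis
        using B in_V[OF f] \<open>i \<in> ?V\<close> \<open>j \<in> ?V\<close> unfolding theta_feasible_def by blast
    qed
    then show ?thesis by (simp add: B'_def)
  qed
  have trans: "\<exists>g\<in>A. g u = v" if uv: "u \<in> ?V" "v \<in> ?V" for u v
  proof -
    obtain f where f: "automorphism G f" "f u = v"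
      using vt uv unfolding vertex_transitive_def by blast
    then obtain g where "automorphism G g" "g permutes ?V" "g u = f u"
      using automorphism_permutes[OF f(1)] uv(1) by metis
    then show ?thesis using f(2) by (auto simp: A_def)
  qed
  have diag_const: "B' v v = B' u u" if "u \<in> ?V" "v \<in> ?V" for u v
    using trans[OF that] inv by auto
  have row_const: "(\<Sum>j\<in>?V. B' v j) = (\<Sum>j\<in>?V. B' u j)" if uv: "u \<in> ?V" "v \<in> ?V" for u v
  proof -
    obtain g where g: "g \<in> A" "g u = v" using trans[OF uv] by auto
    have "(\<Sum>j\<in>?V. B' v j) = (\<Sum>j\<in>?V. B' (g u) (g j))"
      unfolding g(2) by (rule sum.reindex_bij_betw[OF bij[OF g(1)], symmetric])
    then show ?thesis by (simp add: inv[OF g(1)])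
  qed
  have const: "c i = (\<Sum>j\<in>?V. c j) / n"
    if "i \<in> ?V" "\<And>j. j \<in> ?V \<Longrightarrow> c j = c i" for i and c :: "'a \<Rightarrow> real"
  proof -
    have "(\<Sum>j\<in>?V. c j) = (\<Sum>j\<in>?V. c i)"
      by (rule sum.cong[OF refl that(2)])
    then show ?thesis using n by (simp add: n_def)
  qed
  show ?thesis
  proof (rule that[of B'])
    show "theta_feasible G B'"
      using psd trace zero by (auto simp: theta_feasible_def)
  next
    fix i assume i: "i \<in> ?V"
    show "B' i i = 1 / n"
      using const[OF i, of "\<lambda>i. B' i i", OF diag_const[OF i]] trace by simp
    show "(\<Sum>j\<in>?V. B' i j) = (\<Sum>i\<in>?V. \<Sum>j\<in>?V. B i j) / n"
      using const[OF i, of "\<lambda>i. \<Sum>j\<in>?V. B' i j", OF row_const[OF i]] total by simp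
  qed
qed

lemma vertex_transitive_complement:
  assumes "vertex_transitive G"
  shows "vertex_transitive (complement G)"
proof -
  have "automorphism (complement G) f" if "automorphism G f" for f
    using that unfolding automorphism_def adj_complement bij_betw_def inj_on_def by auto
  then show ?thesis
    using assms unfolding vertex_transitive_def by fastforce
qed

text \<open>For averaged \<open>B\<close> and \<open>C\<close> the product \<open>Tr (B C)\<close> only sees the diagonals, hence is
  \<open>1 / n\<close>, whereas \<open>B\<close> dominates the multiple of \<open>J\<close> with the same row sums.\<close>

lemma theta_feasible_mult_le:
  assumes G: "simple_graph G" "verts G \<noteq> {}" and vt: "vertex_transitive G"
    and B: "theta_feasible G B" and C: "theta_feasible (complement G) C"
  shows "(\<Sum>i\<in>verts G. \<Sum>j\<in>verts G. B i j) * (\<Sum>i\<in>verts G. \<Sum>j\<in>verts G. C i j) \<le> card (verts G)"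
proof -
  let ?V = "verts G"
  define n where "n = real (card ?V)"
  define s where "s = (\<Sum>i\<in>?V. \<Sum>j\<in>?V. B i j)"
  define t where "t = (\<Sum>i\<in>?V. \<Sum>j\<in>?V. C i j)"
  have fin: "finite ?V" using G(1) by (rule finite_verts)
  have n: "n > 0" using G fin by (simp add: n_def card_gt_0_iff)
  obtain B' where B': "theta_feasible G B'" "\<And>i. i \<in> ?V \<Longrightarrow> B' i i = 1 / n"
    "\<And>i. i \<in> ?V \<Longrightarrow> (\<Sum>j\<in>?V. B' i j) = s / n"
    unfolding n_def s_def by (rule theta_feasible_average[OF G vt B]) blast
  obtain C' where C': "theta_feasible (complement G) C'" "\<And>i. i \<in> ?V \<Longrightarrow> C' i i = 1 / n"
    "\<And>i. i \<in> ?V \<Longrightarrow> (\<Sum>j\<in>?V. C' i j) = t / n"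
    using theta_feasible_average[OF simple_graph_complement[OF G(1)] _ vertex_transitive_complement[OF vt] C] G(2)
    unfolding n_def t_def verts_complement by blast
  have BC: "B' i j * C' i j = (if i = j then 1 / n\<^sup>2 else 0)" if "i \<in> ?V" "j \<in> ?V" for i j
    using that B' C' G(1) unfolding theta_feasible_def adj_complement simple_graph_def
    by (cases "adj G i j") (auto simp: power2_eq_square)
  have "psd_on ?V (\<lambda>i j. B' i j - s / n / card ?V)"
    by (rule psd_on_minus_const[OF fin G(2)]) (use B' in \<open>auto simp: theta_feasible_def\<close>)
  then have "0 \<le> (\<Sum>i\<in>?V. \<Sum>j\<in>?V. (B' i j - s / n / card ?V) * C' i j)"
    using C'(1) by (intro psd_on_inner[OF fin]) (auto simp: theta_feasible_def)
  also have "\<dots> = (\<Sum>i\<in>?V. \<Sum>j\<in>?V. B' i j * C' i j) - s / n / n * (\<Sum>i\<in>?V. \<Sum>j\<in>?V. C' i j)"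
    by (simp add: left_diff_distrib sum_subtractf n_def sum_distrib_left sum_divide_distrib)
  also have "\<dots> = n * (1 / n\<^sup>2) - s / n / n * (n * (t / n))"
    using fin by (simp add: BC C'(3) flip: n_def)
  finally have "0 \<le> (n - s * t) / n\<^sup>2"
    using n by (simp add: power2_eq_square diff_divide_distrib)
  then show ?thesis
    using n unfolding s_def t_def n_def by (simp add: zero_le_divide_iff)
qed

text \<open>The suprema are taken one factor at a time, first over \<open>B\<close> with
  \<open>C\<close> fixed. Nonpositive values of \<open>C\<close> are set apart, since the bound is
  divided by that value.\<close>

lemma theta_mult_theta_complement_le:
  assumes G: "simple_graph G" "verts G \<noteq> {}" and vt: "vertex_transitive G"
  shows "lovasz_theta G * lovasz_theta (complement G) \<le> card (verts G)"
proof -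
  have GC: "simple_graph (complement G)" "verts (complement G) \<noteq> {}"
    using G simple_graph_complement by auto
  have pos: "lovasz_theta G > 0" "lovasz_theta (complement G) > 0"
    using one_le_theta[OF G] one_le_theta[OF GC] by linarith+
  have *: "lovasz_theta G * t \<le> card (verts G)"
    if C: "theta_feasible (complement G) C" and t: "t = (\<Sum>i\<in>verts G. \<Sum>j\<in>verts G. C i j)" for C t
  proof (cases "t > 0")
    case True
    have "lovasz_theta G \<le> card (verts G) / t"
      using theta_feasible_mult_le[OF G vt _ C] True
      by (intro theta_le[OF G]) (simp add: pos_le_divide_eq t)
    then show ?thesis using True by (simp add: pos_le_divide_eq)
  next
    case False
    then have "lovasz_theta G * t \<le> 0" using pos by (simp add: mult_le_0_iff)
    then show ?thesis by linarith
  qed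
  have "lovasz_theta (complement G) \<le> card (verts G) / lovasz_theta G"
    using * pos by (intro theta_le[OF GC]) (simp add: pos_le_divide_eq mult.commute)
  then show ?thesis using pos by (simp add: pos_le_divide_eq mult.commute)
qed

section \<open>Strongly regular graphs\<close>

text \<open>These bounds fix signs later on: \<open>m \<le> d\<close> makes the discriminant
  nonnegative, \<open>l < d\<close> keeps the smaller root negative even if \<open>m = d\<close>,
  and \<open>d < n\<close> keeps the denominator of the complement's bound positive.\<close>

lemma strongly_regular_degree_bounds:
  assumes G: "simple_graph G" and srg: "strongly_regular_params G n d l m"
  shows "0 < d" "l < d" "m \<le> d" "d < n"
proof -
  have fin: "finite (verts G)" using G by (rule finite_verts)
  have fin_nb: "finite (neighbours G x)" for x
    using fin by (simp add: neighbours_def)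
  obtain x y where xy: "adj G x y" using srg by (auto simp: strongly_regular_params_def)
  then have V: "x \<in> verts G" "y \<in> verts G" using G by (auto simp: simple_graph_def)
  have dx: "card (neighbours G x) = d" using srg V by (simp add: strongly_regular_params_def)
  have y_in: "y \<in> neighbours G x" "y \<notin> neighbours G y"
    using xy V G by (auto simp: neighbours_def simple_graph_def)
  then have "neighbours G x \<inter> neighbours G y \<subset> neighbours G x" by auto
  from psubset_card_mono[OF fin_nb this] show "l < d"
    using srg V xy dx by (simp add: strongly_regular_params_def)
  then show "0 < d" by simp
  obtain u v where uv: "u \<in> verts G" "v \<in> verts G" "u \<noteq> v" "\<not> adj G u v"
    using srg by (auto simp: strongly_regular_params_def)
  have "card (neighbours G u \<inter> neighbours G v) \<le> card (neighbours G u)"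
    by (rule card_mono[OF fin_nb]) simp
  then show "m \<le> d"
    using srg uv by (simp add: strongly_regular_params_def)
  have "neighbours G x \<subset> verts G"
    using V G by (auto simp: neighbours_def simple_graph_def)
  from psubset_card_mono[OF fin this] show "d < n"
    using srg dx by (simp add: strongly_regular_params_def)
qed

text \<open>The matrix identity \<open>A\<^sup>2 = d I + l A + m (J - I - A)\<close>, read as an
  identity of quadratic forms at \<open>x\<close>, with \<open>y = A x\<close>.\<close>

lemma strongly_regular_sums:
  fixes x :: "'a \<Rightarrow> real"
  assumes G: "simple_graph G" and srg: "strongly_regular_params G n d l m"
  defines "A \<equiv> \<lambda>i j. of_bool (adj G i j) :: real"
  defines "S \<equiv> \<Sum>i\<in>verts G. x i" and "P \<equiv> \<Sum>i\<in>verts G. (x i)\<^sup>2"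
    and "Q \<equiv> \<Sum>i\<in>verts G. \<Sum>j\<in>verts G. x i * A i j * x j"
    and "y \<equiv> \<lambda>i. \<Sum>j\<in>verts G. A i j * x j"
  shows "(\<Sum>i\<in>verts G. y i) = real d * S"
    and "(\<Sum>i\<in>verts G. (y i)\<^sup>2) = real d * P + real l * Q + real m * (S\<^sup>2 - P - Q)"
    and "(\<Sum>i\<in>verts G. x i * y i) = Q"
proof -
  let ?V = "verts G"
  have fin: "finite ?V" using G by (rule finite_verts)
  have sym: "A i j = A j i" for i j
    using G by (auto simp: A_def simple_graph_def)
  have A2: "(\<Sum>k\<in>?V. A k i * A k j) = real (card (neighbours G i \<inter> neighbours G j))" for i j
  proof -
    have "(\<Sum>k\<in>?V. A k i * A k j) = (\<Sum>k\<in>?V. if k \<in> neighbours G i \<inter> neighbours G j then 1 else 0)"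
      using G by (intro sum.cong refl) (auto simp: A_def neighbours_def simple_graph_def)
    also have "\<dots> = real (card {k \<in> ?V. k \<in> neighbours G i \<inter> neighbours G j})"
      using fin by (simp flip: sum.inter_filter)
    also have "{k \<in> ?V. k \<in> neighbours G i \<inter> neighbours G j} = neighbours G i \<inter> neighbours G j"
      by (auto simp: neighbours_def)
    finally show ?thesis .
  qed
  have "(\<Sum>k\<in>?V. A k i) = real d" if "i \<in> ?V" for i
  proof -
    have "(\<Sum>k\<in>?V. A k i) = (\<Sum>k\<in>?V. A k i * A k i)"
      by (simp add: A_def flip: of_bool_conj)
    then show ?thesis
      using A2[of i i] that srg by (simp add: strongly_regular_params_def)
  qed
  then have "(\<Sum>j\<in>?V. \<Sum>i\<in>?V. A i j * x j) = real d * S"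
    unfolding S_def sum_distrib_left by (intro sum.cong refl) (simp flip: sum_distrib_right)
  then show "(\<Sum>i\<in>?V. y i) = real d * S"
    unfolding y_def by (subst sum.swap)
  show "(\<Sum>i\<in>?V. x i * y i) = Q"
    unfolding y_def Q_def sum_distrib_left by (simp add: mult.assoc)
  have entry: "(\<Sum>k\<in>?V. A k i * A k j)
      = (if i = j then real d - real m else 0) + (real l - real m) * A i j + real m"
    if "i \<in> ?V" "j \<in> ?V" for i j
  proof -
    consider "i = j" | "i \<noteq> j" "adj G i j" | "i \<noteq> j" "\<not> adj G i j" by blast
    then show ?thesis
    proof cases
      case 1
      moreover have "\<not> adj G i i" using G by (simp add: simple_graph_def)
      ultimately show ?thesis
        unfolding A2 using that srg by (simp add: A_def strongly_regular_params_def)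
    qed (use that srg in \<open>unfold A2, simp_all add: A_def strongly_regular_params_def\<close>)
  qed
  have "(\<Sum>i\<in>?V. (y i)\<^sup>2) = (\<Sum>k\<in>?V. \<Sum>i\<in>?V. \<Sum>j\<in>?V. (A k i * A k j) * (x i * x j))"
    unfolding y_def power2_eq_square sum_product by (simp add: mult_ac)
  also have "\<dots> = (\<Sum>i\<in>?V. \<Sum>k\<in>?V. \<Sum>j\<in>?V. (A k i * A k j) * (x i * x j))"
    by (rule sum.swap)
  also have "\<dots> = (\<Sum>i\<in>?V. \<Sum>j\<in>?V. \<Sum>k\<in>?V. (A k i * A k j) * (x i * x j))"
    by (rule sum.cong[OF refl], rule sum.swap)
  also have "\<dots> = (\<Sum>i\<in>?V. \<Sum>j\<in>?V. (if i = j then (real d - real m) * (x i)\<^sup>2 else 0)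
      + (real l - real m) * (x i * A i j * x j) + real m * (x i * x j))"
  proof (intro sum.cong refl)
    fix i j assume ij: "i \<in> ?V" "j \<in> ?V"
    show "(\<Sum>k\<in>?V. (A k i * A k j) * (x i * x j)) = (if i = j then (real d - real m) * (x i)\<^sup>2 else 0)
        + (real l - real m) * (x i * A i j * x j) + real m * (x i * x j)"
      unfolding sum_distrib_right[symmetric] entry[OF ij] by (simp add: algebra_simps power2_eq_square)
  qed
  also have "\<dots> = (real d - real m) * P + (real l - real m) * Q + real m * S\<^sup>2"
    unfolding P_def Q_def S_def power2_eq_square sum_product
    using fin by (simp add: sum.distrib flip: sum_distrib_left)
  finally show "(\<Sum>i\<in>?V. (y i)\<^sup>2) = real d * P + real l * Q + real m * (S\<^sup>2 - P - Q)"
    by (simp add: algebra_simps)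
qed

text \<open>If \<open>\<alpha>\<close> and \<open>\<beta>\<close> are the two nontrivial eigenvalues, then
  \<open>(A - \<alpha>)\<^sup>2 = m J + (\<beta> - \<alpha>) (A - \<alpha>)\<close>; the inequality is Cauchy-Schwarz for \<open>(A - \<alpha>) x\<close>.\<close>

lemma strongly_regular_eigenvalue_ineq:
  fixes x :: "'a \<Rightarrow> real" and \<alpha> \<beta> :: real
  assumes G: "simple_graph G" and srg: "strongly_regular_params G n d l m"
    and roots: "\<alpha> + \<beta> = real l - real m" "\<alpha> * \<beta> = real m - real d"
  shows "(real d - \<alpha>) * (real d - \<beta>) = real m * real n"
    and "real n * ((\<beta> - \<alpha>) * ((\<Sum>i\<in>verts G. \<Sum>j\<in>verts G. x i * of_bool (adj G i j) * x j)
           - \<alpha> * (\<Sum>i\<in>verts G. (x i)\<^sup>2)))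
         \<ge> (real d - \<alpha>) * (\<beta> - \<alpha>) * (\<Sum>i\<in>verts G. x i)\<^sup>2"
proof -
  let ?V = "verts G"
  have fin: "finite ?V" using G by (rule finite_verts)
  have n: "card ?V = n" using srg by (simp add: strongly_regular_params_def)
  have n_pos: "n > 0" using strongly_regular_degree_bounds[OF G srg] by simp
  have l: "real l = \<alpha> + \<beta> + real m" and d: "real d = real m - \<alpha> * \<beta>" using roots by simp_all
  have deg: "(\<Sum>j\<in>?V. of_bool (adj G i j)) = real d" if "i \<in> ?V" for i
  proof -
    have "(\<Sum>j\<in>?V. of_bool (adj G i j)) = real (card (neighbours G i))"
      using fin by (simp add: neighbours_def of_bool_def flip: sum.inter_filter)
    then show ?thesis using srg that by (simp add: strongly_regular_params_def)
  qed
  \<comment> \<open>The all-ones vector in the identity for \<open>A\<^sup>2\<close> gives the usual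
    parameter relation between \<open>n\<close>, \<open>d\<close>, \<open>l\<close> and
    \<open>m\<close>.\<close>
  have "real n * (real d)\<^sup>2 = real d * n + real l * (n * d) + m * ((real n)\<^sup>2 - n - n * d)"
    using strongly_regular_sums(2)[OF G srg, of "\<lambda>_. 1"] by (simp add: deg n)
  also have "\<dots> = real n * (d + real l * d + real m * (real n - 1 - d))"
    by (simp add: algebra_simps power2_eq_square)
  finally have count: "(real d)\<^sup>2 = d + real l * d + real m * (real n - 1 - d)"
    using n_pos by (metis mult_cancel_left of_nat_eq_0_iff less_irrefl)
  show *: "(real d - \<alpha>) * (real d - \<beta>) = real m * real n"
  proof -
    have "(d - \<alpha>) * (d - \<beta>) = (real d)\<^sup>2 - real d * (\<alpha> + \<beta>) + \<alpha> * \<beta>"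
      by (simp add: algebra_simps power2_eq_square)
    then show ?thesis
      unfolding roots count by (simp add: algebra_simps)
  qed
  define S where "S = (\<Sum>i\<in>?V. x i)"
  define P where "P = (\<Sum>i\<in>?V. (x i)\<^sup>2)"
  define Q where "Q = (\<Sum>i\<in>?V. \<Sum>j\<in>?V. x i * of_bool (adj G i j) * x j)"
  define y where "y i = (\<Sum>j\<in>?V. of_bool (adj G i j) * x j)" for i
  note sums = strongly_regular_sums[OF G srg, of x, folded S_def P_def Q_def y_def]
  have "(\<Sum>i\<in>?V. y i - \<alpha> * x i) = (d - \<alpha>) * S"
    by (simp add: sum_subtractf sums S_def algebra_simps flip: sum_distrib_left)
  moreover have "(\<Sum>i\<in>?V. (y i - \<alpha> * x i)\<^sup>2) = (\<beta> - \<alpha>) * (Q - \<alpha> * P) + m * S\<^sup>2"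
  proof -
    have "(\<Sum>i\<in>?V. (y i - \<alpha> * x i)\<^sup>2) = (\<Sum>i\<in>?V. (y i)\<^sup>2 - 2 * \<alpha> * (x i * y i) + \<alpha>\<^sup>2 * (x i)\<^sup>2)"
      by (intro sum.cong refl) (simp add: algebra_simps power2_eq_square)
    also have "\<dots> = (\<Sum>i\<in>?V. (y i)\<^sup>2) - 2 * \<alpha> * Q + \<alpha>\<^sup>2 * P"
      by (simp add: sum.distrib sum_subtractf sums(3) P_def flip: sum_distrib_left)
    also have "\<dots> = (\<beta> - \<alpha>) * (Q - \<alpha> * P) + m * S\<^sup>2"
      unfolding sums(2) l d by (simp add: algebra_simps power2_eq_square)
    finally show ?thesis .
  qed
  ultimately have "((d - \<alpha>) * S)\<^sup>2 \<le> ((\<beta> - \<alpha>) * (Q - \<alpha> * P) + m * S\<^sup>2) * n"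
    using sum_squared_le_sum_of_squares[of "\<lambda>i. y i - \<alpha> * x i" ?V] n by simp
  \<comment> \<open>Writes \<open>d - \<alpha>\<close> as
    \<open>(\<beta> - \<alpha>) + (d - \<beta>)\<close>; by the first claim the second part cancels
    the term with \<open>m * n\<close>.\<close>
  moreover have "((d - \<alpha>) * S)\<^sup>2 = (d - \<alpha>) * (\<beta> - \<alpha>) * S\<^sup>2 + (d - \<alpha>) * (d - \<beta>) * S\<^sup>2"
    by (simp add: algebra_simps power2_eq_square)
  ultimately show "real n * ((\<beta> - \<alpha>) * (Q - \<alpha> * P)) \<ge> (d - \<alpha>) * (\<beta> - \<alpha>) * S\<^sup>2"
    unfolding * by (simp add: algebra_simps)
qed

text \<open>\<open>s\<close> is Hoffman's ratio bound from degree \<open>d\<close> and least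
  eigenvalue \<tau>; \<open>t\<close> is the same bound for the complement, with degree
  \<open>n - 1 - d\<close> and least eigenvalue \<open>- 1 - \<theta>\<close>.\<close>

lemma strongly_regular_dual_feasible:
  assumes G: "simple_graph G" and srg: "strongly_regular_params G n d l m"
    and roots: "\<theta> + \<tau> = real l - real m" "\<theta> * \<tau> = real m - real d" and "\<theta> \<ge> 0" "\<tau> < 0"
  defines "s \<equiv> n * \<tau> / (\<tau> - d)" and "t \<equiv> n * (1 + \<theta>) / (real n - real d + \<theta>)"
  shows "dual_feasible G s" "dual_feasible (complement G) t" "s * t = n"
proof -
  let ?V = "verts G"
  let ?a = "\<lambda>i j. of_bool (adj G i j) :: real"
  have fin: "finite ?V" using G by (rule finite_verts)
  have roots': "\<tau> + \<theta> = real l - real m" "\<tau> * \<theta> = real m - real d" using roots by (auto simp: mult.commute)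
  have d: "d < n" using strongly_regular_degree_bounds[OF G srg] by simp
  have pos: "real d - \<tau> > 0" "real n - d + \<theta> > 0" "1 + \<theta> > 0" "\<theta> - \<tau> > 0"
    using assms(5,6) d by auto
  note ineq = strongly_regular_eigenvalue_ineq(2)[OF G srg]
  have sym: "?a i j = ?a j i" for i j
    using G by (auto simp: simple_graph_def)
  have irr: "\<not> adj G i i" for i
    using G by (auto simp: simple_graph_def)
  have quad: "(\<Sum>i\<in>?V. \<Sum>j\<in>?V. x i * (p * of_bool (i = j) + q * ?a i j + r) * x j)
      = p * (\<Sum>i\<in>?V. (x i)\<^sup>2) + q * (\<Sum>i\<in>?V. \<Sum>j\<in>?V. x i * ?a i j * x j) + r * (\<Sum>i\<in>?V. x i)\<^sup>2"
    for x :: "'a \<Rightarrow> real" and p q r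
  proof -
    have "(\<Sum>i\<in>?V. \<Sum>j\<in>?V. x i * (p * of_bool (i = j) + q * ?a i j + r) * x j)
        = (\<Sum>i\<in>?V. \<Sum>j\<in>?V. (if i = j then p * (x i)\<^sup>2 else 0) + q * (x i * ?a i j * x j) + r * (x i * x j))"
      by (intro sum.cong refl) (simp add: algebra_simps power2_eq_square)
    also have "\<dots> = p * (\<Sum>i\<in>?V. (x i)\<^sup>2) + q * (\<Sum>i\<in>?V. \<Sum>j\<in>?V. x i * ?a i j * x j)
        + r * (\<Sum>i\<in>?V. \<Sum>j\<in>?V. x i * x j)"
      using fin by (simp add: sum.distrib flip: sum_distrib_left)
    finally show ?thesis
      by (simp only: power2_eq_square sum_product)
  qed
  have psd: "psd_on ?V (\<lambda>i j. p * of_bool (i = j) + q * ?a i j + r)"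
    if "\<And>x. p * (\<Sum>i\<in>?V. (x i)\<^sup>2) + q * (\<Sum>i\<in>?V. \<Sum>j\<in>?V. x i * ?a i j * x j) + r * (\<Sum>i\<in>?V. x i)\<^sup>2 \<ge> 0"
    for p q r
    by (rule psd_onI) (use that quad sym in \<open>auto simp: eq_commute\<close>)
  \<comment> \<open>The certificate is \<open>s (I - A / \<tau>)\<close>, scaled so that its
    eigenvalue at the all-ones vector is \<open>n\<close>, that of \<open>J\<close>.\<close>
  show "dual_feasible G s"
    unfolding dual_feasible_def
  proof (intro exI[of _ "\<lambda>i j. s * of_bool (i = j) + (- s / \<tau>) * ?a i j"] conjI ballI impI)
    have "s * (\<Sum>i\<in>?V. (x i)\<^sup>2) + (- s / \<tau>) * (\<Sum>i\<in>?V. \<Sum>j\<in>?V. x i * ?a i j * x j) + (- 1) * (\<Sum>i\<in>?V. x i)\<^sup>2 \<ge> 0"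
      for x :: "'a \<Rightarrow> real"
    proof -
      define S where "S = (\<Sum>i\<in>?V. x i)"
      define P where "P = (\<Sum>i\<in>?V. (x i)\<^sup>2)"
      define Q where "Q = (\<Sum>i\<in>?V. \<Sum>j\<in>?V. x i * ?a i j * x j)"
      have "(\<theta> - \<tau>) * ((d - \<tau>) * S\<^sup>2) \<le> (\<theta> - \<tau>) * (n * (Q - \<tau> * P))"
        using ineq[OF roots', of x] by (simp add: S_def P_def Q_def mult_ac)
      then have "(d - \<tau>) * S\<^sup>2 \<le> n * (Q - \<tau> * P)"
        using pos(4) by (rule mult_left_le_imp_le)
      then have "S\<^sup>2 \<le> n * (Q - \<tau> * P) / (d - \<tau>)"
        using pos(1) by (simp add: pos_le_divide_eq mult.commute)
      also have "\<dots> = s * P + (- s / \<tau>) * Q"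
        using pos(1) assms(6) by (simp add: s_def divide_simps) (simp add: algebra_simps)
      finally show ?thesis by (simp add: S_def P_def Q_def)
    qed
    from psd[OF this] show "psd_on ?V (\<lambda>i j. s * of_bool (i = j) + - s / \<tau> * ?a i j - 1)"
      by simp
  qed (auto simp: irr)
  \<comment> \<open>The same shape for the complement,
    \<open>t (I + (J - I - A) / (1 + \<theta>))\<close>, expanded in \<open>I\<close>,
    \<open>A\<close> and \<open>J\<close>.\<close>
  show "dual_feasible (complement G) t"
    unfolding dual_feasible_def verts_complement
  proof (intro exI[of _ "\<lambda>i j. (t * \<theta> / (1 + \<theta>)) * of_bool (i = j) + (- t / (1 + \<theta>)) * ?a i j + t / (1 + \<theta>)"]
      conjI ballI impI)
    have "(t * \<theta> / (1 + \<theta>)) * (\<Sum>i\<in>?V. (x i)\<^sup>2) + (- t / (1 + \<theta>)) * (\<Sum>i\<in>?V. \<Sum>j\<in>?V. x i * ?a i j * x j)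
        + (t / (1 + \<theta>) - 1) * (\<Sum>i\<in>?V. x i)\<^sup>2 \<ge> 0"
      for x :: "'a \<Rightarrow> real"
    proof -
      define S where "S = (\<Sum>i\<in>?V. x i)"
      define P where "P = (\<Sum>i\<in>?V. (x i)\<^sup>2)"
      define Q where "Q = (\<Sum>i\<in>?V. \<Sum>j\<in>?V. x i * ?a i j * x j)"
      \<comment> \<open>Now \<alpha> is \<theta> and \<beta> is \<tau>, so the factor \<beta> -
        \<alpha> is negative and the inequality bounds \<open>Q\<close> from above.\<close>
      have "(\<theta> - \<tau>) * ((\<theta> - d) * S\<^sup>2) \<le> (\<theta> - \<tau>) * (n * (\<theta> * P - Q))"
        using ineq[OF roots, of x] by (simp add: S_def P_def Q_def algebra_simps)
      then have "(\<theta> - d) * S\<^sup>2 \<le> n * (\<theta> * P - Q)"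
        using pos(4) by (rule mult_left_le_imp_le)
      then have "(real n - d + \<theta>) * S\<^sup>2 \<le> n * (\<theta> * P - Q + S\<^sup>2)"
        by (simp add: algebra_simps)
      then have "S\<^sup>2 \<le> n * (\<theta> * P - Q + S\<^sup>2) / (real n - d + \<theta>)"
        using pos(2) by (simp add: pos_le_divide_eq mult.commute)
      also have "\<dots> = t / (1 + \<theta>) * (\<theta> * P - Q + S\<^sup>2)"
        using pos(3) d by (simp add: t_def of_nat_diff)
      finally show ?thesis by (simp add: S_def P_def Q_def algebra_simps)
    qed
    from psd[OF this] show "psd_on ?V (\<lambda>i j. (t * \<theta> / (1 + \<theta>)) * of_bool (i = j) + (- t / (1 + \<theta>)) * ?a i j
        + t / (1 + \<theta>) - 1)"
      by (simp add: algebra_simps)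
  next
    fix i
    show "(t * \<theta> / (1 + \<theta>)) * of_bool (i = i) + (- t / (1 + \<theta>)) * ?a i i + t / (1 + \<theta>) = t"
    proof -
      have "t * \<theta> / (1 + \<theta>) + t / (1 + \<theta>) = t * (1 + \<theta>) / (1 + \<theta>)"
        by (simp only: add_divide_distrib[symmetric]) (simp add: algebra_simps)
      then show ?thesis
        using pos(3) by (simp add: irr)
    qed
  qed (auto simp: adj_complement)
  \<comment> \<open>This is the claim \<open>s * t = n\<close> cleared of denominators; it comes
    down to \<open>(d - \<theta>) * (d - \<tau>) = m * n\<close>.\<close>
  have "n * \<tau> * (1 + \<theta>) = (\<tau> - d) * (real n - d + \<theta>)"
  proof -
    have "(\<tau> - d) * (real n - d + \<theta>) = n * (\<tau> - d) + (d - \<theta>) * (d - \<tau>)"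
      by (simp add: algebra_simps)
    also have "\<dots> = n * (\<tau> - d) + m * n"
      unfolding strongly_regular_eigenvalue_ineq(1)[OF G srg roots] by simp
    also have "\<dots> = n * (\<tau> + \<theta> * \<tau>)"
      unfolding roots(2) by (simp add: algebra_simps)
    finally show ?thesis by (simp add: algebra_simps)
  qed
  then have "s * t = n * ((\<tau> - d) * (real n - d + \<theta>)) / ((\<tau> - d) * (real n - d + \<theta>))"
    using d by (simp add: s_def t_def of_nat_diff mult.assoc mult.left_commute)
  also have "\<dots> = n"
    using pos by simp
  finally show "s * t = n" .
qed

text \<open>The eigenvalues of \<open>A\<close> orthogonal to the all-ones vector are the roots of a
  quadratic with sum \<open>l - m\<close> and product \<open>m - d\<close>; they come from the
  quadratic formula.\<close>

lemma strongly_regular_eigenvalues: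
  assumes G: "simple_graph G" and srg: "strongly_regular_params G n d l m"
  obtains \<theta> \<tau> :: real where "\<theta> + \<tau> = real l - real m" "\<theta> * \<tau> = real m - real d" "\<theta> \<ge> 0" "\<tau> < 0"
proof -
  define b where "b = real l - real m"
  define D where "D = sqrt (b\<^sup>2 + 4 * (real d - real m))"
  have md: "real m \<le> real d" "real l < real d"
    using strongly_regular_degree_bounds[OF G srg] by simp_all
  then have D2: "D * D = b * b + 4 * (real d - real m)"
    by (simp add: D_def power2_eq_square)
  have abs: "\<bar>b\<bar> \<le> D"
    unfolding D_def using md by (intro real_le_rsqrt) simp
  \<comment> \<open>Strictness makes \<tau> negative. For \<open>m = d\<close> it holds because then
    \<open>b = l - d\<close> is negative, otherwise because the discriminant exceeds
    \<open>b * b\<close>.\<close>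
  have "b < D"
  proof (cases "real m = real d")
    case True
    then show ?thesis using md abs by (simp add: b_def)
  next
    case False
    then have "D * D > b * b" using D2 md by simp
    then have "D \<noteq> b" by auto
    then show ?thesis using abs by simp
  qed
  moreover have "(b + D) / 2 * ((b - D) / 2) = real m - real d"
  proof -
    have "(b + D) / 2 * ((b - D) / 2) = (b * b - D * D) / 4"
      by (simp add: algebra_simps)
    then show ?thesis
      unfolding D2 by simp
  qed
  ultimately show ?thesis
    using abs by (intro that[of "(b + D) / 2" "(b - D) / 2"]) (simp_all add: b_def field_simps)
qed

section \<open>The product of a graph with its complement\<close>

lemma card_le_independence_number_product_complement:
  assumes G: "simple_graph G"
  shows "card (verts G) \<le> independence_number (strong_product G (complement G))"
proof -
  have fin: "finite (verts G)" using G by (rule finite_verts)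
  have "independent_set (strong_product G (complement G)) ((\<lambda>x. (x, x)) ` verts G)"
    by (auto simp: independent_set_def adj_strong_product adj_complement)
  from card_le_independence_number[OF _ this] show ?thesis
    using fin by (simp add: card_image inj_on_def)
qed

lemma card_le_dual_feasible_mult:
  assumes G: "simple_graph G" "verts G \<noteq> {}" and "dual_feasible G s" "dual_feasible (complement G) t"
  shows "real (card (verts G)) \<le> s * t"
proof -
  have fin: "finite (verts G)" using G(1) by (rule finite_verts)
  let ?H = "strong_product G (complement G)"
  have "real (independence_number ?H) \<le> s * t"
    by (rule dual_feasible_independence_number_le[OF _ _ dual_feasible_strong_product])
      (use assms fin in \<open>auto simp: adj_strong_product\<close>)
  then show ?thesis
    using card_le_independence_number_product_complement[OF G(1)] by linarith
qed

text \<open>The diagonal bounds the independence number from below and the product certificate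
  bounds the capacity and the theta function from above, both by \<open>n\<close>; the independence
  number lies below both.\<close>

lemma product_complement_eq_card:
  assumes G: "simple_graph G" "verts G \<noteq> {}"
    and dual: "dual_feasible G s" "dual_feasible (complement G) t" and st: "s * t \<le> real (card (verts G))"
  shows "independence_number (strong_product G (complement G)) = card (verts G)"
    and "shannon_capacity (strong_product G (complement G)) = card (verts G)"
    and "lovasz_theta (strong_product G (complement G)) = card (verts G)"
proof -
  let ?H = "strong_product G (complement G)"
  have fin: "finite (verts G)" using G(1) by (rule finite_verts)
  have H: "simple_graph ?H" "verts ?H \<noteq> {}"
    using G simple_graph_complement simple_graph_strong_product by auto
  have "dual_feasible ?H (s * t)"
    using dual_feasible_strong_product[OF fin _ dual] fin by simp
  moreover have "s * t = real (card (verts G))"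
    using st card_le_dual_feasible_mult[OF G dual] by linarith
  ultimately have H_dual: "dual_feasible ?H (card (verts G))"
    by simp
  have le: "card (verts G) \<le> independence_number ?H"
    by (rule card_le_independence_number_product_complement[OF G(1)])
  have ge: "shannon_capacity ?H \<le> card (verts G)" "lovasz_theta ?H \<le> card (verts G)"
    using shannon_capacity_le[OF H H_dual] dual_feasible_theta_le[OF H H_dual] by auto
  then show "independence_number ?H = card (verts G)"
    "shannon_capacity ?H = card (verts G)" "lovasz_theta ?H = card (verts G)"
    using le independence_number_le_shannon_capacity[OF H] independence_number_le_theta[OF H] by linarith+
qed

lemma strongly_regular_dual_feasible_mult:
  assumes G: "simple_graph G" and srg: "strongly_regular G"
  shows "\<exists>s t. dual_feasible G s \<and> dual_feasible (complement G) t \<and> s * t = real (card (verts G))"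
proof -
  obtain n d l m where params: "strongly_regular_params G n d l m"
    using srg by (auto simp: strongly_regular_def)
  obtain \<theta> \<tau> where "\<theta> + \<tau> = real l - real m" "\<theta> * \<tau> = real m - real d" "\<theta> \<ge> 0" "\<tau> < 0"
    using strongly_regular_eigenvalues[OF G params] .
  from strongly_regular_dual_feasible[OF G params this] show ?thesis
    using params unfolding strongly_regular_params_def by blast
qed

lemma dual_feasible_mult_le_card:
  assumes G: "simple_graph G" "verts G \<noteq> {}" and "vertex_transitive G \<or> strongly_regular G"
  obtains s t where "dual_feasible G s" "dual_feasible (complement G) t" "s * t \<le> real (card (verts G))"
  using assms(3)
proof
  assume "vertex_transitive G"
  then show ?thesis
    using that dual_feasible_theta[OF G(1)] dual_feasible_theta[OF simple_graph_complement[OF G(1)]]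
      theta_mult_theta_complement_le[OF G] by blast
next
  assume "strongly_regular G"
  then show ?thesis
    using that strongly_regular_dual_feasible_mult[OF G(1)] by force
qed

lemma conference_graph_theta:
  assumes G: "simple_graph G" "verts G \<noteq> {}" and "conference_graph G"
  shows "lovasz_theta G = sqrt (card (verts G))"
proof -
  define n where "n = card (verts G)"
  define q where "q = sqrt (real n)"
  obtain d l m where params: "strongly_regular_params G n d l m" and n: "n \<ge> 5"
    and d: "real d = (real n - 1) / 2" and l: "real l = (real n - 5) / 4" and m: "real m = (real n - 1) / 4"
    using assms(3) by (auto simp: conference_graph_def n_def Let_def)
  have q: "q * q = n" "q > 1"
    using n by (simp_all add: q_def)
  \<comment> \<open>The nontrivial eigenvalues of a conference graph are half of
    \<open>- 1 + q\<close> and half of \<open>- 1 - q\<close>; with them Hoffman's bound simplifies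
    to \<open>q\<close>.\<close>
  note dual = strongly_regular_dual_feasible[OF G(1) params, of "(q - 1) / 2" "- (q + 1) / 2"]
  have roots: "(q - 1) / 2 + - (q + 1) / 2 = real l - real m"
    "(q - 1) / 2 * (- (q + 1) / 2) = real m - real d"
    unfolding d l m q(1)[symmetric] by (simp_all add: field_simps)
  define t where "t = n * (1 + (q - 1) / 2) / (real n - real d + (q - 1) / 2)"
  have "real n * (- (q + 1) / 2) = q * - (q * (q + 1) / 2)"
    unfolding q(1)[symmetric] by (simp add: algebra_simps)
  moreover have "- (q + 1) / 2 - real d = - (q * (q + 1) / 2)"
    unfolding d q(1)[symmetric] by (simp add: field_simps)
  ultimately have "real n * (- (q + 1) / 2) / (- (q + 1) / 2 - d) = q"
    using q(2) by simp
  then have dual': "dual_feasible G q" "dual_feasible (complement G) t" "q * t = n"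
    using dual[OF roots] q(2) unfolding t_def by simp_all
  from dual'(3) have "t = q"
    using q by (metis mult_cancel_left less_irrefl not_one_less_zero)
  \<comment> \<open>The lower bound comes from the complement: its certificate also has value
    \<open>q\<close>, and its product with the theta value is at least \<open>n\<close>.\<close>
  then have "q * q \<le> lovasz_theta G * q"
    using card_le_dual_feasible_mult[OF G dual_feasible_theta[OF G(1)] dual'(2)] q(1) by (simp add: n_def)
  then have "q \<le> lovasz_theta G" using q(2) by simp
  moreover have "lovasz_theta G \<le> q"
    by (rule dual_feasible_theta_le[OF G dual'(1)])
  ultimately show ?thesis by (simp add: q_def n_def)
qed

section \<open>Self-complementary graphs\<close>

text \<open>The Erdos-Szekeres recursion with the binomial coefficient relaxed to a power of two.
  Counting the set sizes as \<open>Suc a\<close> and \<open>Suc b\<close> makes each step lower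
  \<open>a + b\<close> by one and halve the number of vertices.\<close>

lemma ramsey_power_two:
  fixes R :: "'a \<Rightarrow> 'a \<Rightarrow> bool"
  assumes "finite V" "2 ^ (a + b) \<le> card V" and sym: "\<And>x y. R x y \<Longrightarrow> R y x"
  shows "\<exists>S\<subseteq>V. (card S = Suc a \<and> (\<forall>x\<in>S. \<forall>y\<in>S. x \<noteq> y \<longrightarrow> R x y)) \<or>
                (card S = Suc b \<and> (\<forall>x\<in>S. \<forall>y\<in>S. x \<noteq> y \<longrightarrow> \<not> R x y))"
  using assms(1,2)
proof (induction "a + b" arbitrary: a b V)
  case 0
  then obtain v where "v \<in> V" by fastforce
  with 0 show ?case by (intro exI[of _ "{v}"]) auto
next
  case (Suc N)
  have "card V \<noteq> 0" using Suc.prems(2) by (metis not_numeral_le_zero power_not_zero zero_neq_numeral le_zero_eq)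
  then obtain v where v: "v \<in> V" by fastforce
  show ?case
  proof (cases "a = 0 \<or> b = 0")
    case True
    then show ?thesis using v by (intro exI[of _ "{v}"]) auto
  next
    case False
    then obtain a' b' where ab: "a = Suc a'" "b = Suc b'" by (metis not0_implies_Suc)
    define N1 where "N1 = {w \<in> V - {v}. R v w}"
    define N2 where "N2 = {w \<in> V - {v}. \<not> R v w}"
    have fin: "finite N1" "finite N2" and sub: "N1 \<subseteq> V" "N2 \<subseteq> V"
      using Suc.prems(1) by (auto simp: N1_def N2_def)
    have "N1 \<union> N2 = V - {v}" "N1 \<inter> N2 = {}" by (auto simp: N1_def N2_def)
    then have "card N1 + card N2 = card V - 1"
      using v Suc.prems(1) fin by (metis card_Un_disjoint card_Diff_singleton)
    moreover have "2 * 2 ^ N \<le> card V" using Suc.prems(2) Suc.hyps(2)[symmetric] by simp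
    moreover have "0 < card V" using \<open>card V \<noteq> 0\<close> by simp
    \<comment> \<open>If both parts had fewer than \<open>2 ^ N\<close> vertices, together they
      would have at most \<open>2 * 2 ^ N - 2\<close>, fewer than remain after removing
      \<open>v\<close>.\<close>
    ultimately consider "2 ^ N \<le> card N1" | "2 ^ N \<le> card N2" by linarith
    then show ?thesis
    proof cases
      case 1
      have "N = a' + b" using Suc.hyps(2) ab by simp
      from Suc.hyps(1)[OF this fin(1)] 1 this obtain S where S: "S \<subseteq> N1"
        "(card S = Suc a' \<and> (\<forall>x\<in>S. \<forall>y\<in>S. x \<noteq> y \<longrightarrow> R x y)) \<or>
         (card S = Suc b \<and> (\<forall>x\<in>S. \<forall>y\<in>S. x \<noteq> y \<longrightarrow> \<not> R x y))"
        by auto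
      have "v \<notin> S" "finite S" using S(1) fin by (auto simp: N1_def intro: finite_subset)
      then have c: "card (insert v S) = Suc (card S)" by simp
      have vS: "R v x" "R x v" if "x \<in> S" for x
        using that S(1) sym by (auto simp: N1_def)
      from S(2) show ?thesis
      proof
        assume "card S = Suc a' \<and> (\<forall>x\<in>S. \<forall>y\<in>S. x \<noteq> y \<longrightarrow> R x y)"
        then show ?thesis
          using c ab S(1) sub(1) v vS by (intro exI[of _ "insert v S"]) auto
      next
        assume "card S = Suc b \<and> (\<forall>x\<in>S. \<forall>y\<in>S. x \<noteq> y \<longrightarrow> \<not> R x y)"
        then show ?thesis
          using S(1) sub(1) by (intro exI[of _ S]) auto
      qed
    next
      case 2
      have "N = a + b'" using Suc.hyps(2) ab by simp
      from Suc.hyps(1)[OF this fin(2)] 2 this obtain S where S: "S \<subseteq> N2"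
        "(card S = Suc a \<and> (\<forall>x\<in>S. \<forall>y\<in>S. x \<noteq> y \<longrightarrow> R x y)) \<or>
         (card S = Suc b' \<and> (\<forall>x\<in>S. \<forall>y\<in>S. x \<noteq> y \<longrightarrow> \<not> R x y))"
        by auto
      have "v \<notin> S" "finite S" using S(1) fin by (auto simp: N2_def intro: finite_subset)
      then have c: "card (insert v S) = Suc (card S)" by simp
      have vS: "\<not> R v x" "\<not> R x v" if "x \<in> S" for x
        using that S(1) sym by (auto simp: N2_def)
      from S(2) show ?thesis
      proof
        assume "card S = Suc a \<and> (\<forall>x\<in>S. \<forall>y\<in>S. x \<noteq> y \<longrightarrow> R x y)"
        then show ?thesis
          using S(1) sub(2) by (intro exI[of _ S]) auto
      next
        assume "card S = Suc b' \<and> (\<forall>x\<in>S. \<forall>y\<in>S. x \<noteq> y \<longrightarrow> \<not> R x y)"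
        then show ?thesis
          using c ab S(1) sub(2) v vS by (intro exI[of _ "insert v S"]) auto
      qed
    qed
  qed
qed

section \<open>Transfer along the isomorphism with the complement\<close>

lemma self_complementary_obtain:
  assumes "self_complementary G"
  obtains f where "bij_betw f (verts G) (verts G)"
    "\<And>x y. x \<in> verts G \<Longrightarrow> y \<in> verts G \<Longrightarrow> adj G x y \<longleftrightarrow> x \<noteq> y \<and> \<not> adj G (f x) (f y)"
proof -
  obtain f where f: "bij_betw f (verts G) (verts G)"
    "\<And>x y. x \<in> verts G \<Longrightarrow> y \<in> verts G \<Longrightarrow> adj G x y \<longleftrightarrow> adj (complement G) (f x) (f y)"
    using assms unfolding self_complementary_def by blast
  have "adj G x y \<longleftrightarrow> x \<noteq> y \<and> \<not> adj G (f x) (f y)" if "x \<in> verts G" "y \<in> verts G" for x y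
  proof -
    have "f x \<in> verts G" "f y \<in> verts G" "f x = f y \<longleftrightarrow> x = y"
      using f(1) that by (auto simp: bij_betw_def inj_on_eq_iff)
    then show ?thesis
      unfolding f(2)[OF that] by (simp add: adj_complement)
  qed
  then show ?thesis by (rule that[OF f(1)])
qed

text \<open>The map \<open>f\<close> is an isomorphism from \<open>G\<close> to its complement and
  also from the complement to \<open>G\<close>, so certificates are pulled back along
  \<open>f\<close> in both directions.\<close>

lemma self_complementary_dual_feasible:
  assumes G: "simple_graph G" and sc: "self_complementary G"
  shows "dual_feasible (complement G) t \<longleftrightarrow> dual_feasible G t"
proof -
  obtain f where f: "bij_betw f (verts G) (verts G)"
    "\<And>x y. x \<in> verts G \<Longrightarrow> y \<in> verts G \<Longrightarrow> adj G x y \<longleftrightarrow> x \<noteq> y \<and> \<not> adj G (f x) (f y)"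
    using self_complementary_obtain[OF sc] by blast
  have irr: "\<not> adj G x x" for x using G by (auto simp: simple_graph_def)
  have f_in: "f x \<in> verts G" if "x \<in> verts G" for x
    using f(1) that by (auto simp: bij_betw_def)
  have f_eq: "f x = f y \<longleftrightarrow> x = y" if "x \<in> verts G" "y \<in> verts G" for x y
    using f(1) that by (auto simp: bij_betw_def inj_on_eq_iff)
  show ?thesis
  proof
    have "adj G x y \<longleftrightarrow> adj (complement G) (f x) (f y)" if "x \<in> verts G" "y \<in> verts G" for x y
      unfolding f(2)[OF that] adj_complement using that f_in f_eq by simp
    then show "dual_feasible G t" if "dual_feasible (complement G) t"
      using that f(1) by (intro dual_feasible_iso[of f G "complement G"]) simp_all
  next
    have "adj (complement G) x y \<longleftrightarrow> adj G (f x) (f y)" if "x \<in> verts G" "y \<in> verts G" for x y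
      unfolding adj_complement f(2)[OF that] using that irr by (cases "x = y") simp_all
    then show "dual_feasible (complement G) t" if "dual_feasible G t"
      using that f(1) by (intro dual_feasible_iso[of f "complement G" G]) simp_all
  qed
qed

text \<open>Makes the graph of \<open>f\<close> independent in the strong square: two vertices
  confusable in the first coordinate are separated in the second.\<close>

lemma self_complementary_separating_map:
  assumes "self_complementary G"
  obtains f where "\<And>x. x \<in> verts G \<Longrightarrow> f x \<in> verts G"
    "\<And>x y. x \<in> verts G \<Longrightarrow> y \<in> verts G \<Longrightarrow> x \<noteq> y \<Longrightarrow> adj G x y \<Longrightarrow> f x \<noteq> f y \<and> \<not> adj G (f x) (f y)"
proof -
  obtain f where f: "bij_betw f (verts G) (verts G)"
    "\<And>x y. x \<in> verts G \<Longrightarrow> y \<in> verts G \<Longrightarrow> adj G x y \<longleftrightarrow> x \<noteq> y \<and> \<not> adj G (f x) (f y)"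
    using self_complementary_obtain[OF assms] by blast
  show ?thesis
  proof (rule that[of f])
    show "f x \<in> verts G" if "x \<in> verts G" for x
      using f(1) that by (auto simp: bij_betw_def)
    show "f x \<noteq> f y \<and> \<not> adj G (f x) (f y)"
      if "x \<in> verts G" "y \<in> verts G" "x \<noteq> y" "adj G x y" for x y
    proof -
      have "f x = f y \<longleftrightarrow> x = y"
        using f(1) that(1,2) by (auto simp: bij_betw_def inj_on_eq_iff)
      then show ?thesis
        using that(3,4) unfolding f(2)[OF that(1,2)] by simp
    qed
  qed
qed

lemma self_complementary_sqrt_le_capacity:
  assumes G: "simple_graph G" "verts G \<noteq> {}" and sc: "self_complementary G"
  shows "sqrt (card (verts G)) \<le> shannon_capacity G"
proof -
  have fin: "finite (verts G)" using G(1) by (rule finite_verts)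
  obtain f where f: "\<And>x. x \<in> verts G \<Longrightarrow> f x \<in> verts G"
    "\<And>x y. x \<in> verts G \<Longrightarrow> y \<in> verts G \<Longrightarrow> x \<noteq> y \<Longrightarrow> adj G x y \<Longrightarrow> f x \<noteq> f y \<and> \<not> adj G (f x) (f y)"
    using self_complementary_separating_map[OF sc] by blast
  have "independent_set (strong_power G 2) ((\<lambda>x. [x, f x]) ` verts G)"
    unfolding independent_set_def adj_strong_power verts_strong_power
    using f by (auto simp: numeral_2_eq_2 All_less_Suc2)
  from card_le_independence_number[OF finite_strong_power[OF fin] this]
  have "card (verts G) \<le> independence_number (strong_power G 2)"
    by (simp add: card_image inj_on_def)
  then have "sqrt (card (verts G)) \<le> root 2 (independence_number (strong_power G 2))"
    by (simp add: sqrt_def)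
  also have "\<dots> \<le> shannon_capacity G"
    by (rule root_independence_number_le_shannon_capacity[OF G]) simp
  finally show ?thesis .
qed

lemma self_complementary_card_le_independence_number_square:
  assumes G: "simple_graph G" and sc: "self_complementary G"
  shows "card (verts G) \<le> independence_number (strong_product G G)"
proof -
  have fin: "finite (verts G)" using G(1) by (rule finite_verts)
  obtain f where f: "\<And>x. x \<in> verts G \<Longrightarrow> f x \<in> verts G"
    "\<And>x y. x \<in> verts G \<Longrightarrow> y \<in> verts G \<Longrightarrow> x \<noteq> y \<Longrightarrow> adj G x y \<Longrightarrow> f x \<noteq> f y \<and> \<not> adj G (f x) (f y)"
    using self_complementary_separating_map[OF sc] by blast
  have "independent_set (strong_product G G) ((\<lambda>x. (x, f x)) ` verts G)"
    using f by (auto simp: independent_set_def adj_strong_product)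
  from card_le_independence_number[OF _ this] show ?thesis
    using fin by (simp add: card_image inj_on_def)
qed

text \<open>With \<open>4 ^ k\<close> vertices the Ramsey bound yields a homogeneous set of size
  \<open>k + 1\<close>; if it is a clique, its image under \<open>f\<close> is independent, so
  either way the independence number would exceed \<open>k\<close>.\<close>

lemma self_complementary_card_less:
  assumes G: "simple_graph G" and sc: "self_complementary G"
  shows "card (verts G) < 4 ^ independence_number G"
proof (rule ccontr)
  let ?k = "independence_number G"
  assume "\<not> card (verts G) < 4 ^ ?k"
  then have "2 ^ (?k + ?k) \<le> card (verts G)"
    by (simp add: power_add flip: power_mult_distrib)
  moreover have fin: "finite (verts G)" using G by (rule finite_verts)
  ultimately obtain S where S: "S \<subseteq> verts G" "card S = Suc ?k"
    "(\<forall>x\<in>S. \<forall>y\<in>S. x \<noteq> y \<longrightarrow> adj G x y) \<or> (\<forall>x\<in>S. \<forall>y\<in>S. x \<noteq> y \<longrightarrow> \<not> adj G x y)"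
    using ramsey_power_two[of "verts G" ?k ?k "adj G"] G unfolding simple_graph_def by metis
  obtain f where f: "bij_betw f (verts G) (verts G)"
    "\<And>x y. x \<in> verts G \<Longrightarrow> y \<in> verts G \<Longrightarrow> adj G x y \<longleftrightarrow> x \<noteq> y \<and> \<not> adj G (f x) (f y)"
    using self_complementary_obtain[OF sc] by blast
  have irr: "\<not> adj G x x" for x using G by (auto simp: simple_graph_def)
  have "\<exists>T. independent_set G T \<and> card T = Suc ?k"
    using S(3)
  proof
    assume *: "\<forall>x\<in>S. \<forall>y\<in>S. x \<noteq> y \<longrightarrow> adj G x y"
    have "\<not> adj G (f x) (f y)" if "x \<in> S" "y \<in> S" for x y
      using * that f(2)[of x y] S(1) irr by (cases "x = y") auto
    moreover have "f ` S \<subseteq> verts G" "inj_on f S"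
      using f(1) S(1) by (auto simp: bij_betw_def intro: inj_on_subset)
    ultimately show ?thesis
      using S(2) by (intro exI[of _ "f ` S"]) (auto simp: independent_set_def card_image)
  next
    assume *: "\<forall>x\<in>S. \<forall>y\<in>S. x \<noteq> y \<longrightarrow> \<not> adj G x y"
    have "\<not> adj G x y" if "x \<in> S" "y \<in> S" for x y
      using * that irr by (cases "x = y") auto
    then show ?thesis
      using S(1,2) by (intro exI[of _ S]) (auto simp: independent_set_def)
  qed
  then show False
    using card_le_independence_number[OF fin] by force
qed

text \<open>The exponent is \<open>1 - 2 / (k + 1)\<close>, and the missing factor, \<open>n\<close>
  to the power \<open>2 / (k + 1)\<close>, is at most 4 to the power \<open>2 * k / (k + 1)\<close>,
  hence below \<open>4\<^sup>2\<close>. This is where 16 comes from.\<close>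

lemma le_sixteen_powr:
  fixes n k :: nat
  assumes "0 < n" "n \<le> 4 ^ k"
  shows "real n \<le> 16 * real n powr ((real k - 1) / (real k + 1))"
proof -
  have "real n \<le> 4 ^ k"
    using of_nat_mono[OF assms(2), where ?'a = real] by simp
  also have "(4 :: real) ^ k = 4 powr real k"
    by (simp add: powr_realpow)
  finally have "real n powr (2 / (real k + 1)) \<le> (4 powr real k) powr (2 / (real k + 1))"
    by (intro powr_mono2) auto
  also have "\<dots> = 4 powr (real k * (2 / (real k + 1)))"
    by (rule powr_powr)
  also have "\<dots> \<le> 4 powr 2"
    by (intro powr_mono) (auto simp: field_simps)
  also have "\<dots> = (16 :: real)"
    by simp
  finally have *: "real n powr (2 / (real k + 1)) \<le> 16" .
  have "2 / (real k + 1) + (real k - 1) / (real k + 1) = 1"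
    unfolding add_divide_distrib[symmetric] by (subst divide_eq_1_iff) linarith
  then have "real n = real n powr (2 / (real k + 1) + (real k - 1) / (real k + 1))"
    using assms(1) by simp
  also have "\<dots> = real n powr (2 / (real k + 1)) * real n powr ((real k - 1) / (real k + 1))"
    by (rule powr_add)
  also have "\<dots> \<le> 16 * real n powr ((real k - 1) / (real k + 1))"
    by (intro mult_right_mono *) simp
  finally show ?thesis .
qed

lemma self_complementary_optimal:
  assumes G: "simple_graph G" "verts G \<noteq> {}" and sc: "self_complementary G"
    and sym: "vertex_transitive G \<or> strongly_regular G"
  shows "shannon_capacity G = sqrt (card (verts G))"
    and "lovasz_theta G = sqrt (card (verts G))"
    and "independence_number (strong_product G G) = card (verts G)"
proof -
  have fin: "finite (verts G)" using G(1) by (rule finite_verts)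
  obtain s t where st: "dual_feasible G s" "dual_feasible (complement G) t" "s * t \<le> real (card (verts G))"
    using dual_feasible_mult_le_card[OF G sym] .
  \<comment> \<open>Both values are certified for \<open>G\<close> by self-complementarity, and the
    smaller one has square at most \<open>s * t\<close>.\<close>
  define u where "u = min s t"
  have u: "dual_feasible G u"
    using st(1,2) self_complementary_dual_feasible[OF G(1) sc] by (simp add: u_def min_def)
  have "s \<ge> 1" "t \<ge> 1"
    using dual_feasible_ge_one[OF fin G(2) st(1)] dual_feasible_ge_one[OF _ _ st(2)] fin G(2) by simp_all
  then have "u * u \<le> s * t" "u \<ge> 0"
    unfolding u_def by (auto intro: mult_mono)
  with st(3) have u2: "u * u \<le> real (card (verts G))" by linarith
  then have u_le: "u \<le> sqrt (card (verts G))"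
    by (intro real_le_rsqrt) (simp add: power2_eq_square)
  show "shannon_capacity G = sqrt (card (verts G))"
    using shannon_capacity_le[OF G u] u_le self_complementary_sqrt_le_capacity[OF G sc] by linarith
  \<comment> \<open>The theta value is certified for \<open>G\<close> and for its complement at
    once, so its square is at least \<open>n\<close>.\<close>
  have "dual_feasible G (lovasz_theta G)" "dual_feasible (complement G) (lovasz_theta G)"
    using dual_feasible_theta[OF G(1)] self_complementary_dual_feasible[OF G(1) sc] by auto
  from card_le_dual_feasible_mult[OF G this] have "sqrt (card (verts G)) \<le> lovasz_theta G"
    using one_le_theta[OF G] by (intro real_le_lsqrt) (auto simp: power2_eq_square)
  then show "lovasz_theta G = sqrt (card (verts G))"
    using dual_feasible_theta_le[OF G u] u_le by linarith
  have "real (independence_number (strong_product G G)) \<le> u * u"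
    by (rule dual_feasible_independence_number_le[OF _ _ dual_feasible_strong_product[OF fin fin u u]])
      (use fin G in \<open>auto simp: adj_strong_product\<close>)
  then show "independence_number (strong_product G G) = card (verts G)"
    using u2 self_complementary_card_le_independence_number_square[OF G(1) sc] by linarith
qed

theorem mainTheorem1:
  fixes G :: "'a sgraph" and n :: nat
  assumes graph: "simple_graph G"
    and nonempty: "verts G \<noteq> {}"
    and n_def: "n = card (verts G)"
  shows
    "((vertex_transitive G \<or> strongly_regular G) \<longrightarrow>
        real (independence_number (strong_product G (complement G))) = real n \<and>
        shannon_capacity (strong_product G (complement G)) = real n \<and>
        lovasz_theta (strong_product G (complement G)) = real n)
     \<and> (conference_graph G \<longrightarrow> lovasz_theta G = sqrt (real n))
     \<and> (self_complementary G \<longrightarrow>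
          (let k = independence_number G in
             sqrt (real n) \<le> shannon_capacity G \<and>
             shannon_capacity G \<le> 16 * real n powr ((real k - 1) / (real k + 1))))
     \<and> (self_complementary G \<and> (vertex_transitive G \<or> strongly_regular G) \<longrightarrow>
          shannon_capacity G = sqrt (real n) \<and> lovasz_theta G = sqrt (real n) \<and>
          sqrt (real (independence_number (strong_product G G))) = shannon_capacity G \<and>
          (\<forall>H :: 'a sgraph. simple_graph H \<and> card (verts H) = n \<and> self_complementary H
             \<longrightarrow> shannon_capacity G \<le> shannon_capacity H))"
proof -
  have "shannon_capacity G \<le> 16 * real n powr ((real k - 1) / (real k + 1))"
    if "self_complementary G" "k = independence_number G" for k
  proof -
    have "n > 0"
      using nonempty finite_verts[OF graph] by (simp add: n_def card_gt_0_iff)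
    then have "real n \<le> 16 * real n powr ((real k - 1) / (real k + 1))"
      using self_complementary_card_less[OF graph that(1)] that(2)
      by (intro le_sixteen_powr) (simp_all add: n_def)
    then show ?thesis
      using shannon_capacity_le[OF graph nonempty dual_feasible_card[OF finite_verts[OF graph]]]
      by (simp add: n_def)
  qed
  moreover have "shannon_capacity G \<le> shannon_capacity H"
    if "self_complementary G" "vertex_transitive G \<or> strongly_regular G"
      "simple_graph H" "card (verts H) = n" "self_complementary H" for H :: "'a sgraph"
  proof -
    have "verts H \<noteq> {}"
      using that(4) nonempty finite_verts[OF graph] by (auto simp: n_def)
    from self_complementary_sqrt_le_capacity[OF that(3) this that(5)] show ?thesis
      using self_complementary_optimal(1)[OF graph nonempty that(1,2)] that(4) by (simp add: n_def)
  qed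
  moreover have "real (independence_number (strong_product G (complement G))) = real n \<and>
      shannon_capacity (strong_product G (complement G)) = real n \<and>
      lovasz_theta (strong_product G (complement G)) = real n"
    if "vertex_transitive G \<or> strongly_regular G"
    using dual_feasible_mult_le_card[OF graph nonempty that]
      product_complement_eq_card[OF graph nonempty] unfolding n_def by (metis (no_types))
  ultimately show ?thesis
    using conference_graph_theta[OF graph nonempty] self_complementary_sqrt_le_capacity[OF graph nonempty]
      self_complementary_optimal[OF graph nonempty]
    unfolding Let_def n_def by (intro conjI impI allI) auto
qed

end
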